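(* Suppose that: (i) $c(x,x')=(x-x')^TA(x)(x-x')$ is lower semicontinuous and there are positive constants $\rho_{\min},\rho_{\max}$ with $\rho_{\min}\le v^TA(x)v\le\rho_{\max}$ for all unit vectors $v$ and $P_0$-almost every $x\in\mathbb{R}^d$; (ii) $\ell:\mathbb{R}\to\mathbb{R}$ is convex, $\kappa:=\inf\{s\ge0:\sup_{u\in\mathbb{R}}(\ell(u)-su^2)<\infty\}$ is finite, and $E_{P_0}\|X\|^4<\infty$; (iii) $\ell$ is twice differentiable with $\ell''(\cdot)\le M$ for a positive constant $M$, and for every $\beta\in B$ the random variable $\ell'(\beta^TX)$ is not identically $0$ (i.e. $P_0(\ell'(\beta^TX)\neq0)>0$); (iv) $B\subseteq\mathbb{R}^d$ is convex and compact, with $R_\beta:=\sup_{\beta\in B}\|\beta\|<\infty$; (v) $\ell$ is locally strongly convex, and there exist $c_1,c_2\in(0,\infty)$ and $p\in(0,1)$ such that $P_0\big(|\ell'(\beta^TX)|>c_1,\ |\beta^TX|>c_2\|\beta\|\big)\ge p$ for every $\beta\in B$. Then there exist constants $\delta_1\in(0,\delta_0)$ and $\kappa_1\in(0,\infty)$ (not depending on $\delta$) such that, whenever $\delta<\delta_1$, the Hessian of $f_\delta:B\times\mathbb{R}_+\to\mathbb{R}\cup\{\infty\}$ (with respect to $\theta=(\beta,\lambda)$) satisfies $$\nabla^2f_\delta(\theta)\succeq\sqrt\delta\,\kappa_1\,\mathbb{I}_{d+1}\qquad\text{for }\theta\in\mathbb{V}.$$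
   Context: Let $d\ge1$, $B\subseteq\mathbb{R}^d$ nonempty, $\delta>0$, $P_0$ a Borel probability measure on $\mathbb{R}^d$, $\ell:\mathbb{R}\to\mathbb{R}$, and $A:\mathbb{R}^d\to\mathbb{S}_d^{++}$ (real symmetric positive definite $d\times d$ matrices). $E_{P_0}$ denotes expectation with $X\sim P_0$, $\mathbb{R}_+=[0,\infty)$, $\|\cdot\|$ is the Euclidean norm, $\mathbb{I}_{d+1}$ the identity matrix, and $\succeq$ the positive semidefinite order. Locally strongly convex means: on every compact interval there is $m>0$ such that $u\mapsto\ell(u)-mu^2/2$ is convex there. Define $$F(\gamma,\beta,\lambda;x)=\ell\big(\beta^Tx+\gamma\sqrt\delta\,\beta^TA(x)^{-1}\beta\big)-\lambda\sqrt\delta\,\big(\gamma^2\beta^TA(x)^{-1}\beta-1\big),$$ $\ell_{rob}(\beta,\lambda;x)=\sup_{\gamma\in\mathbb{R}}F(\gamma,\beta,\lambda;x)$ and $f_\delta(\beta,\lambda)=E_{P_0}[\ell_{rob}(\beta,\lambda;X)]$; these formulas make sense for all $\beta\in\mathbb{R}^d$, which is how derivatives at boundary points of $B$ are understood. Let $$\mathbb{V}=\{(\beta,\lambda)\in B\times\mathbb{R}_+:K_1\|\beta\|\le\lambda\le K_2\|\beta\|\},\quad K_1=\tfrac12\sqrt{\underline L\,\rho_{\max}^{-1}},\quad K_2=\tfrac12\sqrt\delta\,MR_\beta\rho_{\min}^{-1}+\sqrt{\rho_{\min}^{-1}\overline L},$$ where $\underline L,\overline L>0$ are constants (which exist under the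 hypotheses, and do not depend on $\delta$) with $\underline L\le E_{P_0}[\ell'(\beta^TX)^2]\le\overline L$ for every $\beta\in B$. Finally $\delta_0:=\rho_{\min}^2\,\underline L\,R_\beta^{-2}M^{-2}\rho_{\max}^{-1}$. *)

theory Defs
  imports "HOL-Probability.Probability"
begin

definition spd_matrices :: "(real ^ 'n ^ 'n) set" where
  "spd_matrices = {S. transpose S = S \<and> (\<forall>v. v \<noteq> 0 \<longrightarrow> 0 < v \<bullet> (S *v v))}"

definition lower_semicontinuous :: "('a::topological_space \<Rightarrow> real) \<Rightarrow> bool" where
  "lower_semicontinuous f \<longleftrightarrow> (\<forall>x. \<forall>r < f x. \<forall>\<^sub>F z in nhds x. r < f z)"

definition locally_strongly_convex :: "(real \<Rightarrow> real) \<Rightarrow> bool" where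
  "locally_strongly_convex l \<longleftrightarrow>
     (\<forall>a b. a \<le> b \<longrightarrow> (\<exists>m>0. convex_on {a..b} (\<lambda>u. l u - m * u\<^sup>2 / 2)))"

text \<open>The growth rate is an extended real, so that the infimum of the empty set is \<open>\<infinity>\<close>.\<close>

definition growth_rate :: "(real \<Rightarrow> real) \<Rightarrow> ereal" where
  "growth_rate l = Inf {ereal s | s. 0 \<le> s \<and> (SUP u. ereal (l u - s * u\<^sup>2)) < \<infinity>}"

definition transport_cost :: "(real ^ 'n \<Rightarrow> real ^ 'n ^ 'n) \<Rightarrow> real ^ 'n \<Rightarrow> real ^ 'n \<Rightarrow> real" where
  "transport_cost A x x' = (x - x') \<bullet> (A x *v (x - x'))"

definition dual_objective ::
  "(real \<Rightarrow> real) \<Rightarrow> (real ^ 'n \<Rightarrow> real ^ 'n ^ 'n) \<Rightarrow> real \<Rightarrow> real \<Rightarrow> real ^ 'n \<Rightarrow> real \<Rightarrow> real ^ 'n \<Rightarrow> real" where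
  "dual_objective l A \<delta> \<gamma> \<beta> lam x =
     l (\<beta> \<bullet> x + \<gamma> * sqrt \<delta> * (\<beta> \<bullet> (matrix_inv (A x) *v \<beta>)))
     - lam * sqrt \<delta> * (\<gamma>\<^sup>2 * (\<beta> \<bullet> (matrix_inv (A x) *v \<beta>)) - 1)"

definition robust_loss ::
  "(real \<Rightarrow> real) \<Rightarrow> (real ^ 'n \<Rightarrow> real ^ 'n ^ 'n) \<Rightarrow> real \<Rightarrow> real ^ 'n \<Rightarrow> real \<Rightarrow> real ^ 'n \<Rightarrow> ereal" where
  "robust_loss l A \<delta> \<beta> lam x = (SUP \<gamma>. ereal (dual_objective l A \<delta> \<gamma> \<beta> lam x))"

text \<open>Expectation of an extended-real random variable, as the difference of the integrals of its
  positive and negative parts (\<^const>\<open>e2ennreal\<close> sends negative values to 0).\<close>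

definition ereal_expectation :: "'a measure \<Rightarrow> ('a \<Rightarrow> ereal) \<Rightarrow> ereal" where
  "ereal_expectation P f =
     enn2ereal (\<integral>\<^sup>+x. e2ennreal (f x) \<partial>P) - enn2ereal (\<integral>\<^sup>+x. e2ennreal (- f x) \<partial>P)"

definition robust_objective ::
  "(real ^ 'n) measure \<Rightarrow> (real \<Rightarrow> real) \<Rightarrow> (real ^ 'n \<Rightarrow> real ^ 'n ^ 'n) \<Rightarrow> real
     \<Rightarrow> (real ^ 'n) \<times> real \<Rightarrow> ereal" where
  "robust_objective P l A \<delta> = (\<lambda>(\<beta>, lam). ereal_expectation P (robust_loss l A \<delta> \<beta> lam))"

definition radius :: "'a::real_normed_vector set \<Rightarrow> real" where
  "radius B = (SUP \<beta>\<in>B. norm \<beta>)"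

definition K1 :: "real \<Rightarrow> real \<Rightarrow> real" where
  "K1 Llow \<rho>max = 1 / 2 * sqrt (Llow * inverse \<rho>max)"

definition K2 :: "real \<Rightarrow> real \<Rightarrow> real \<Rightarrow> real \<Rightarrow> real \<Rightarrow> real" where
  "K2 Lup \<rho>min M R \<delta> = 1 / 2 * sqrt \<delta> * M * R * inverse \<rho>min + sqrt (inverse \<rho>min * Lup)"

definition strong_convexity_region ::
  "(real ^ 'n) set \<Rightarrow> real \<Rightarrow> real \<Rightarrow> real \<Rightarrow> real \<Rightarrow> real \<Rightarrow> real \<Rightarrow> ((real ^ 'n) \<times> real) set" where
  "strong_convexity_region B Llow Lup \<rho>min \<rho>max M \<delta> =
     {(\<beta>, lam). \<beta> \<in> B \<and> 0 \<le> lam \<and> K1 Llow \<rho>max * norm \<beta> \<le> lam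
                 \<and> lam \<le> K2 Lup \<rho>min M (radius B) \<delta> * norm \<beta>}"

definition delta0 :: "real \<Rightarrow> real \<Rightarrow> real \<Rightarrow> real \<Rightarrow> real \<Rightarrow> real" where
  "delta0 Llow \<rho>min \<rho>max M R = \<rho>min\<^sup>2 * Llow / (R\<^sup>2 * M\<^sup>2 * \<rho>max)"

text \<open>The Hessian at \<open>\<theta>\<close> is the Frechet derivative at \<open>\<theta>\<close> of the gradient, as a linear operator on
  the Euclidean space; the function is required to be finite and differentiable on a whole
  neighbourhood of \<open>\<theta>\<close>.\<close>

definition has_hessian ::
  "('a::euclidean_space \<Rightarrow> ereal) \<Rightarrow> ('a \<Rightarrow> 'a) \<Rightarrow> 'a \<Rightarrow> bool" where
  "has_hessian f H \<theta> \<longleftrightarrow>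
     (\<exists>g. (\<forall>\<^sub>F y in nhds \<theta>. \<bar>f y\<bar> \<noteq> \<infinity> \<and> (GDERIV (\<lambda>z. real_of_ereal (f z)) y :> g y))
        \<and> (g has_derivative H) (at \<theta>))"

definition psd_operator :: "('a::euclidean_space \<Rightarrow> 'a) \<Rightarrow> bool" where
  "psd_operator T \<longleftrightarrow> linear T \<and> (\<forall>u v. T u \<bullet> v = u \<bullet> T v) \<and> (\<forall>v. 0 \<le> v \<bullet> T v)"

definition loewner_ge :: "('a::euclidean_space \<Rightarrow> 'a) \<Rightarrow> ('a \<Rightarrow> 'a) \<Rightarrow> bool" where
  "loewner_ge S T \<longleftrightarrow> psd_operator (\<lambda>v. S v - T v)"

end

theory Submission
  imports Defs
begin

text \<open>
  Put \<open>s = sqrt \<delta>\<close>, \<open>P = A(x)\<inverse>\<close>, \<open>t = \<beta>\<^sup>Tx\<close> and \<open>q = s \<beta>\<^sup>TP\<beta> / (2\<lambda>)\<close>. For \<open>qM < 1\<close> the inner supremum equals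
  \<open>s\<lambda> + e(t,q)\<close>, where \<open>e(t,q) = l(u) - q l'(u)\<^sup>2 / 2\<close> and \<open>u\<close> is the unique solution of \<open>u = t + q l'(u)\<close>. With \<open>g = l'(u)\<close>
  one has \<open>de = g dt + g\<^sup>2/2 dq\<close>, so the Hessian of the robust loss is \<open>D a a\<^sup>T + (g\<^sup>2/2) \<nabla>\<^sup>2q\<close> with
  \<open>D = l''(u) / (1 - q l''(u))\<close> and \<open>a = (x,0) + g \<nabla>q\<close>. No continuity of \<open>l''\<close> is needed: \<open>u\<close> is
  differentiable as a continuous inverse of a differentiable map, and the gradient is differentiated
  under the expectation by dominated convergence.

  As \<open>q\<close> is quadratic over linear, \<open>\<nabla>\<^sup>2q\<close> controls the part \<open>w = v - (\<mu>/\<lambda>)\<beta>\<close> of a direction \<open>(v,\<mu>)\<close> with a factor of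
  order \<open>s\<close>, and along the ray through \<open>(\<beta>,\<lambda>)\<close> the rank-one term gives \<open>D (\<mu>/\<lambda>)\<^sup>2 u\<^sup>2\<close>. The spread condition
  bounds \<open>|g|\<close> and \<open>|u|\<close>, and local strong convexity bounds \<open>l''(u)\<close>, from below on an event of probability at least \<open>p/2\<close> on which \<open>x\<close> is bounded.
\<close>

section \<open>Differentiation under the integral\<close>

text \<open>On the convex set \<open>S\<close> the mean value inequality turns the bound on the
  derivatives into a Lipschitz bound with constant \<open>h x\<close>. The remainder quotients are
  therefore dominated by \<open>2 * h x\<close>, and they tend to 0 for almost every
  \<open>x\<close>. The derivatives have to exist on \<open>S\<close> but not to be continuous
  there, so the result applies to a gradient whose derivative involves a possibly discontinuous
  second derivative.\<close>

lemma has_derivative_integral: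
  fixes f :: "'a::{real_normed_vector, perfect_space} \<Rightarrow> 'x \<Rightarrow> 'b::{banach, second_countable_topology}"
  assumes S: "open S" "convex S" "\<theta> \<in> S"
    and meas: "\<And>y. y \<in> S \<Longrightarrow> f y \<in> borel_measurable M"
    and meas': "\<And>h. (\<lambda>x. f' \<theta> x h) \<in> borel_measurable M"
    and int: "integrable M (f \<theta>)"
    and h: "integrable M h"
    and deriv: "AE x in M. \<forall>y\<in>S. ((\<lambda>y. f y x) has_derivative f' y x) (at y)"
    and bound: "AE x in M. \<forall>y\<in>S. \<forall>v. norm (f' y x v) \<le> h x * norm v"
  shows "\<And>y. y \<in> S \<Longrightarrow> integrable M (f y)"
    and "\<And>v. integrable M (\<lambda>x. f' \<theta> x v)"
    and "((\<lambda>y. \<integral>x. f y x \<partial>M) has_derivative (\<lambda>v. \<integral>x. f' \<theta> x v \<partial>M)) (at \<theta>)"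
proof -
  have lip: "AE x in M. \<forall>y\<in>S. norm (f y x - f \<theta> x) \<le> h x * norm (y - \<theta>)"
    using deriv bound
  proof eventually_elim
    case (elim x)
    show ?case
    proof
      fix y assume "y \<in> S"
      then show "norm (f y x - f \<theta> x) \<le> h x * norm (y - \<theta>)"
        using elim S by (intro differentiable_bound[where S = S and f' = "\<lambda>y. f' y x"])
          (auto intro: has_derivative_at_withinI onorm_le)
    qed
  qed
  show int': "integrable M (f y)" if y: "y \<in> S" for y
  proof -
    have "integrable M (\<lambda>x. f y x - f \<theta> x)"
      by (rule Bochner_Integration.integrable_bound[where f = "\<lambda>x. h x * norm (y - \<theta>)"])
        (use lip y h meas[OF y] int in \<open>auto elim!: eventually_mono simp: abs_mult intro: order_trans[OF _ mult_right_mono[OF abs_ge_self norm_ge_zero]]\<close>)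
    then show ?thesis using Bochner_Integration.integrable_add[OF _ int] by fastforce
  qed
  show intd: "integrable M (\<lambda>x. f' \<theta> x v)" for v
    by (rule Bochner_Integration.integrable_bound[where f = "\<lambda>x. h x * norm v"])
      (use bound S(3) h meas'[of v] in \<open>auto elim!: eventually_mono simp: abs_mult intro: order_trans[OF _ mult_right_mono[OF abs_ge_self norm_ge_zero]]\<close>)
  have lin: "AE x in M. bounded_linear (f' \<theta> x)"
    using deriv by eventually_elim (use S(3) has_derivative_bounded_linear in blast)
  have bl: "bounded_linear (\<lambda>v. \<integral>x. f' \<theta> x v \<partial>M)"
  proof (rule bounded_linear_intro[where K = "\<integral>x. h x \<partial>M"])
    fix v w :: 'a and r :: real
    have "(\<integral>x. f' \<theta> x (v + w) \<partial>M) = (\<integral>x. f' \<theta> x v + f' \<theta> x w \<partial>M)"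
      by (rule integral_cong_AE) (use lin meas' in \<open>auto elim!: eventually_mono dest: bounded_linear.linear linear_add\<close>)
    then show "(\<integral>x. f' \<theta> x (v + w) \<partial>M) = (\<integral>x. f' \<theta> x v \<partial>M) + (\<integral>x. f' \<theta> x w \<partial>M)"
      using intd by simp
    have "(\<integral>x. f' \<theta> x (r *\<^sub>R v) \<partial>M) = (\<integral>x. r *\<^sub>R f' \<theta> x v \<partial>M)"
      by (rule integral_cong_AE) (use lin meas' in \<open>auto elim!: eventually_mono dest: bounded_linear.linear linear_scale\<close>)
    then show "(\<integral>x. f' \<theta> x (r *\<^sub>R v) \<partial>M) = r *\<^sub>R (\<integral>x. f' \<theta> x v \<partial>M)"
      by simp
    have "norm (\<integral>x. f' \<theta> x v \<partial>M) \<le> (\<integral>x. h x * norm v \<partial>M)"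
      by (rule integral_norm_bound_integral[THEN order_trans[rotated]] order_trans[OF integral_norm_bound] integral_mono_AE)+
        (use intd h bound S(3) in \<open>auto elim!: eventually_mono\<close>)
    then show "norm (\<integral>x. f' \<theta> x v \<partial>M) \<le> norm v * (\<integral>x. h x \<partial>M)"
      by (simp add: mult.commute)
  qed
  \<comment> \<open>Dominated convergence concerns sequences, so the limit is tested along an
    arbitrary sequence tending to \<open>\<theta>\<close>.\<close>
  have "((\<lambda>y. norm ((\<integral>x. f y x \<partial>M) - (\<integral>x. f \<theta> x \<partial>M) - (\<integral>x. f' \<theta> x (y - \<theta>) \<partial>M)) / norm (y - \<theta>)) \<longlongrightarrow> 0) (at \<theta>)"
    unfolding tendsto_at_iff_sequentially
  proof (intro allI impI)
    fix X assume X: "\<forall>i. X i \<in> UNIV - {\<theta>}" and lim: "X \<longlonglongrightarrow> \<theta>"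
    \<comment> \<open>Terms outside \<open>S\<close> are replaced by \<open>\<theta>\<close>, so
      that the bounds valid on \<open>S\<close> hold at every index; eventually \<open>X\<close> and
      \<open>Y\<close> agree.\<close>
    define Y where "Y i = (if X i \<in> S then X i else \<theta>)" for i
    define r where "r i x = (f (Y i) x - f \<theta> x - f' \<theta> x (Y i - \<theta>)) /\<^sub>R norm (Y i - \<theta>)" for i x
    have YS: "Y i \<in> S" for i using S(3) by (auto simp: Y_def)
    have ev: "\<forall>\<^sub>F i in sequentially. X i = Y i"
      using topological_tendstoD[OF lim S(1,3)] by eventually_elim (auto simp: Y_def)
    have "(\<lambda>i. \<integral>x. r i x \<partial>M) \<longlonglongrightarrow> (\<integral>x. 0 \<partial>M)"
    proof (rule integral_dominated_convergence[where w = "\<lambda>x. 2 * h x"])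
      show "AE x in M. (\<lambda>i. r i x) \<longlonglongrightarrow> 0"
        using deriv
      proof eventually_elim
        case (elim x)
        then have "((\<lambda>y. f y x) has_derivative f' \<theta> x) (at \<theta>)" using S(3) by blast
        then have "((\<lambda>y. norm (f y x - f \<theta> x - f' \<theta> x (y - \<theta>)) / norm (y - \<theta>)) \<longlongrightarrow> 0) (at \<theta>)"
          unfolding has_derivative_iff_norm by blast
        then have "(\<lambda>i. norm (f (X i) x - f \<theta> x - f' \<theta> x (X i - \<theta>)) / norm (X i - \<theta>)) \<longlonglongrightarrow> 0"
          unfolding tendsto_at_iff_sequentially using X lim by (auto simp: comp_def)
        then have "(\<lambda>i. norm (r i x)) \<longlonglongrightarrow> 0"
          by (rule Lim_transform_eventually) (use ev in eventually_elim, simp add: r_def divide_simps)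
        then show ?case by (rule tendsto_norm_zero_cancel)
      qed
      show "AE x in M. norm (r i x) \<le> 2 * h x" for i
        using bound lip
      proof eventually_elim
        case (elim x)
        show ?case
        proof (cases "Y i = \<theta>")
          case True
          \<comment> \<open>Here \<open>r i x\<close> vanishes and only \<open>0 \<le> h x\<close>
            remains to be shown; it follows from the bound on \<open>f'\<close> at any nonzero
            vector.\<close>
          obtain b :: 'a where "b = X i - \<theta>" by blast
          with X have "b \<noteq> 0" by auto
          have "0 \<le> h x * norm b" using elim(1) S(3) norm_ge_zero order_trans by blast
          then have "0 \<le> h x" using \<open>b \<noteq> 0\<close> by (simp add: zero_le_mult_iff)
          then show ?thesis using True by (simp add: r_def)
        next
          case False
          have "norm (f (Y i) x - f \<theta> x) \<le> h x * norm (Y i - \<theta>)" using elim(2) YS by blast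
          moreover have "norm (f' \<theta> x (Y i - \<theta>)) \<le> h x * norm (Y i - \<theta>)" using elim(1) S(3) by blast
          ultimately have "norm (f (Y i) x - f \<theta> x - f' \<theta> x (Y i - \<theta>)) \<le> 2 * h x * norm (Y i - \<theta>)"
            using norm_triangle_ineq4[of "f (Y i) x - f \<theta> x" "f' \<theta> x (Y i - \<theta>)"] by linarith
          then show ?thesis using False by (simp add: r_def divide_simps)
        qed
      qed
    qed (use h meas meas' S(3) YS in \<open>auto simp: r_def\<close>)
    then have "(\<lambda>i. norm (\<integral>x. r i x \<partial>M)) \<longlonglongrightarrow> 0"
      by (simp add: tendsto_norm_zero)
    then show "((\<lambda>y. norm ((\<integral>x. f y x \<partial>M) - (\<integral>x. f \<theta> x \<partial>M) - (\<integral>x. f' \<theta> x (y - \<theta>) \<partial>M)) / norm (y - \<theta>)) \<circ> X) \<longlonglongrightarrow> 0"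
      by (rule Lim_transform_eventually)
        (use ev in eventually_elim, simp add: r_def int'[OF YS] int intd divide_simps)
  qed
  then show "((\<lambda>y. \<integral>x. f y x \<partial>M) has_derivative (\<lambda>v. \<integral>x. f' \<theta> x v \<partial>M)) (at \<theta>)"
    using bl by (simp add: has_derivative_iff_norm)
qed

section \<open>The scalar envelope\<close>

text \<open>The functions \<open>l1\<close> and \<open>l2\<close> are the first two derivatives, and
  convexity is expressed as \<open>0 \<le> l2\<close>. Thus \<open>l1\<close> is monotone and
  Lipschitz with constant \<open>M\<close>, while \<open>l2\<close> may be discontinuous.\<close>

locale smooth_loss =
  fixes l l1 l2 :: "real \<Rightarrow> real" and M :: real
  assumes M_pos: "0 < M"
    and l_deriv: "\<And>u. (l has_real_derivative l1 u) (at u)"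
    and l1_deriv: "\<And>u. (l1 has_real_derivative l2 u) (at u)"
    and l2_nonneg: "\<And>u. 0 \<le> l2 u" and l2_le: "\<And>u. l2 u \<le> M"
begin

lemma l1_lipschitz: "\<bar>l1 u - l1 v\<bar> \<le> M * \<bar>u - v\<bar>"
proof -
  have "onorm ((*) (l2 w)) \<le> M" for w
    using l2_nonneg[of w] l2_le[of w] by (intro onorm_le) (auto simp: abs_mult intro!: mult_right_mono)
  then show ?thesis
    using differentiable_bound[of UNIV l1 "\<lambda>u. (*) (l2 u)" M u v] l1_deriv
    by (simp add: has_field_derivative_def)
qed

text \<open>The Lipschitz bound on \<open>l1\<close> fixes the sign of the derivative of
  \<open>f\<close>: nonpositive to the right of 0 and nonnegative to the left. Hence
  \<open>f\<close> is largest at 0.\<close>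

lemma l_le_quadratic: "l (u + h) \<le> l u + l1 u * h + M * h\<^sup>2 / 2"
proof (rule ccontr)
  assume contr: "\<not> ?thesis"
  define f where "f s = l (u + s) - l1 u * s - M * s\<^sup>2 / 2" for s
  have D: "(f has_real_derivative l1 (u + s) - l1 u - M * s) (at s)" for s
    unfolding f_def
    by (rule derivative_eq_intros DERIV_chain'[where f = "\<lambda>s. u + s" and g = l, OF _ l_deriv, THEN DERIV_cong] refl | simp)+
  have b: "\<bar>l1 (u + s) - l1 u\<bar> \<le> M * \<bar>s\<bar>" for s
    using l1_lipschitz[of "u + s" u] by simp
  have "f h \<le> f 0"
  proof (cases "h \<ge> 0")
    case True
    then show ?thesis
    proof (rule DERIV_nonpos_imp_nonincreasing)
      fix s :: real assume "0 \<le> s" "s \<le> h"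
      then have "l1 (u + s) - l1 u - M * s \<le> 0" using b[of s] by (simp add: abs_if split: if_splits)
      then show "\<exists>y. (f has_real_derivative y) (at s) \<and> y \<le> 0" using D by blast
    qed
  next
    case False
    then have "h \<le> 0" by simp
    then show ?thesis
    proof (rule DERIV_nonneg_imp_nondecreasing)
      fix s :: real assume "h \<le> s" "s \<le> 0"
      then have "0 \<le> l1 (u + s) - l1 u - M * s" using b[of s] by (simp add: abs_if split: if_splits)
      then show "\<exists>y. (f has_real_derivative y) (at s) \<and> 0 \<le> y" using D by blast
    qed
  qed
  then show False using contr by (simp add: f_def)
qed

text \<open>The upper bound expands \<open>l\<close> about 0. The lower bound expands it about
  \<open>u\<close>, evaluates at 0, and replaces \<open>l1 u\<close> by \<open>l1 0\<close> through
  monotonicity of \<open>l1\<close>.\<close>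

lemma l_abs_le: "\<bar>l u\<bar> \<le> \<bar>l 0\<bar> + \<bar>l1 0\<bar> * \<bar>u\<bar> + M * u\<^sup>2"
proof -
  have "l u \<le> l 0 + l1 0 * u + M * u\<^sup>2 / 2" using l_le_quadratic[of 0 u] by simp
  moreover have "l 0 \<le> l u + l1 u * (-u) + M * u\<^sup>2 / 2" using l_le_quadratic[of u "-u"] by simp
  moreover have "l1 u * (-u) \<le> - (l1 0 * u)"
  proof -
    have "l1 v \<le> l1 w" if "v \<le> w" for v w
      by (rule DERIV_nonneg_imp_nondecreasing[OF that]) (use l1_deriv l2_nonneg in blast)
    from this[of 0 u] this[of u 0] have "0 \<le> (l1 u - l1 0) * u"
      by (cases "u \<ge> 0") (auto intro: mult_nonneg_nonneg mult_nonpos_nonpos)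
    then show ?thesis by (simp add: algebra_simps)
  qed
  moreover have "\<bar>l1 0 * u\<bar> = \<bar>l1 0\<bar> * \<bar>u\<bar>" by (rule abs_mult)
  moreover have "0 \<le> M * u\<^sup>2" using M_pos by simp
  ultimately show ?thesis by linarith
qed

lemma l1_measurable [measurable]: "l1 \<in> borel_measurable borel"
  by (rule borel_measurable_continuous_onI) (use l1_deriv DERIV_continuous_on in blast)

lemma l_measurable [measurable]: "l \<in> borel_measurable borel"
  by (rule borel_measurable_continuous_onI) (use l_deriv DERIV_continuous_on in blast)

text \<open>A derivative is the pointwise limit of continuous difference quotients, which gives
  measurability without continuity.\<close>

lemma l2_measurable [measurable]: "l2 \<in> borel_measurable borel"
proof (rule borel_measurable_LIMSEQ_real[where u = "\<lambda>i u. (l1 (u + 1 / Suc i) - l1 u) / (1 / Suc i)"])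
  show "(\<lambda>i. (l1 (u + 1 / Suc i) - l1 u) / (1 / Suc i)) \<longlonglongrightarrow> l2 u" for u
  proof -
    have "((\<lambda>h. (l1 (u + h) - l1 u) / h) \<longlongrightarrow> l2 u) (at 0)"
      using l1_deriv[of u] by (simp add: DERIV_def)
    moreover have "filterlim (\<lambda>i. 1 / real (Suc i)) (at 0) sequentially"
      using LIMSEQ_inverse_real_of_nat by (auto simp: filterlim_at inverse_eq_divide)
    ultimately show ?thesis by (rule filterlim_compose)
  qed
qed measurable

text \<open>The junk value 0 outside the domain makes \<open>prox\<close> Borel measurable.\<close>

definition prox :: "real \<times> real \<Rightarrow> real" where
  "prox z = (if \<bar>snd z\<bar> * M < 1 then THE u. u = fst z + snd z * l1 u else 0)"

text \<open>The right-hand side is a contraction in the unknown with factor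
  \<open>\<bar>q\<bar> * M\<close>, so Banach's theorem gives the unique fixed point that
  \<open>THE\<close> selects.\<close>

lemma prox_eq:
  assumes "\<bar>q\<bar> * M < 1"
  shows "prox (t, q) = t + q * l1 (prox (t, q))"
proof -
  have "\<exists>!u. t + q * l1 u = u"
  proof (rule banach_fix_type[of "\<bar>q\<bar> * M"])
    show "\<forall>u v. dist (t + q * l1 u) (t + q * l1 v) \<le> \<bar>q\<bar> * M * dist u v"
      using l1_lipschitz by (auto simp: dist_real_def abs_mult mult.assoc intro!: mult_left_mono simp flip: right_diff_distrib)
  qed (use assms M_pos in auto)
  then have "\<exists>!u. u = t + q * l1 u" by metis
  from theI'[OF this] show ?thesis using assms by (simp add: prox_def)
qed

text \<open>Subtract the two fixed point equations and absorb the difference of the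
  \<open>l1\<close> values on the left. On the right \<open>l1\<close> occurs at the second point
  only, so with that point held fixed the bound tends to 0; this yields continuity.\<close>

lemma prox_diff_le:
  assumes "\<bar>q\<bar> * M < 1" "\<bar>q'\<bar> * M < 1"
  shows "(1 - \<bar>q\<bar> * M) * \<bar>prox (t, q) - prox (t', q')\<bar> \<le> \<bar>t - t'\<bar> + \<bar>q - q'\<bar> * \<bar>l1 (prox (t', q'))\<bar>"
proof -
  let ?u = "prox (t, q)" and ?v = "prox (t', q')"
  have "?u - ?v = (t - t') + q * (l1 ?u - l1 ?v) + (q - q') * l1 ?v"
    using prox_eq[OF assms(1), of t] prox_eq[OF assms(2), of t'] by (simp add: algebra_simps)
  moreover have "\<bar>q * (l1 ?u - l1 ?v)\<bar> \<le> \<bar>q\<bar> * (M * \<bar>?u - ?v\<bar>)"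
    unfolding abs_mult by (intro mult_left_mono l1_lipschitz) auto
  moreover have "\<bar>(q - q') * l1 ?v\<bar> = \<bar>q - q'\<bar> * \<bar>l1 ?v\<bar>" by (rule abs_mult)
  ultimately have "\<bar>?u - ?v\<bar> \<le> \<bar>t - t'\<bar> + \<bar>q\<bar> * (M * \<bar>?u - ?v\<bar>) + \<bar>q - q'\<bar> * \<bar>l1 ?v\<bar>" by linarith
  then show ?thesis by (simp add: algebra_simps)
qed

lemma open_prox_domain: "open {z :: real \<times> real. \<bar>snd z\<bar> * M < 1}"
  by (intro open_Collect_less continuous_intros)

lemma isCont_prox:
  assumes "\<bar>q\<bar> * M < 1"
  shows "isCont prox (t, q)"
proof -
  let ?b = "\<lambda>z. (\<bar>fst z - t\<bar> + \<bar>snd z - q\<bar> * \<bar>l1 (prox (t, q))\<bar>) / (1 - \<bar>snd z\<bar> * M)"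
  have "isCont ?b (t, q)" using assms by (auto intro!: continuous_intros)
  then have b: "(?b \<longlongrightarrow> 0) (at (t, q))" by (simp add: isCont_def)
  have ev: "\<forall>\<^sub>F z in at (t, q). \<bar>snd z\<bar> * M < 1"
    using eventually_at_in_open'[OF open_prox_domain] assms by fastforce
  have "((\<lambda>z. prox z - prox (t, q)) \<longlongrightarrow> 0) (at (t, q))"
  proof (rule Lim_null_comparison[OF _ b])
    show "\<forall>\<^sub>F z in at (t, q). norm (prox z - prox (t, q)) \<le> ?b z"
      using ev
    proof eventually_elim
      case (elim z)
      then show ?case
        using prox_diff_le[of "snd z" q "fst z" t] assms by (simp add: field_simps)
    qed
  qed
  then show ?thesis unfolding isCont_def by (rule LIM_zero_cancel)
qed

lemma prox_measurable [measurable]: "prox \<in> borel_measurable borel"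
proof -
  have "(\<lambda>z. if z \<in> {z. \<bar>snd z\<bar> * M < 1} then prox z else 0) \<in> borel_measurable borel"
    by (rule borel_measurable_continuous_on_if)
      (use open_prox_domain in \<open>auto intro!: continuous_at_imp_continuous_on isCont_prox\<close>)
  moreover have "(\<lambda>z. if z \<in> {z. \<bar>snd z\<bar> * M < 1} then prox z else 0) = prox"
    by (auto simp: prox_def)
  ultimately show ?thesis by simp
qed

text \<open>The quantity \<open>1 - q * l2 u\<close> is the derivative of
  \<open>u - q * l1 u\<close> in \<open>u\<close> and the denominator of every later derivative; the
  bound keeps it positive on the domain of \<open>prox\<close>.\<close>

lemma jacobian_ge: "1 - \<bar>q\<bar> * M \<le> 1 - q * l2 u"
proof -
  have "q * l2 u \<le> \<bar>q\<bar> * M" using l2_nonneg[of u] l2_le[of u] by (intro mult_mono) auto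
  then show ?thesis by simp
qed

text \<open>Carrying \<open>q\<close> along as a second coordinate makes \<open>prox\<close> part of
  a continuous inverse of the explicit map \<open>?f\<close>. A continuous inverse is differentiable
  wherever the derivative of the map is invertible, whereas the inverse function theorem would ask
  for continuity of \<open>l2\<close>.\<close>

lemma has_derivative_prox:
  fixes t q :: real
  assumes q: "\<bar>q\<bar> * M < 1"
  defines "u \<equiv> prox (t, q)"
  shows "(prox has_derivative (\<lambda>h. (fst h + l1 u * snd h) / (1 - q * l2 u))) (at (t, q))"
proof -
  have ne: "1 - q * l2 u \<noteq> 0" using jacobian_ge[of q u] q by linarith
  let ?f = "\<lambda>z. (fst z - snd z * l1 (fst z), snd z)"
  let ?f' = "\<lambda>h. (fst h - (snd h * l1 u + q * (l2 u * fst h)), snd h)"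
  let ?g = "\<lambda>z. (prox z, snd z)"
  let ?g' = "\<lambda>h. ((fst h + l1 u * snd h) / (1 - q * l2 u), snd h)"
  have "(?g has_derivative ?g') (at (t, q))"
  proof (rule has_derivative_inverse_basic[where f = ?f and f' = ?f' and T = "{z. \<bar>snd z\<bar> * M < 1}"])
    have l1': "(l1 has_derivative (*) (l2 u)) (at u)" using l1_deriv by (simp add: has_field_derivative_def)
    show "(?f has_derivative ?f') (at (?g (t, q)))"
      by (rule derivative_eq_intros has_derivative_compose[where f = fst and g = l1] refl l1' | simp add: u_def[symmetric] l1' add.commute)+
    show "bounded_linear ?g'"
      by (intro bounded_linear_Pair bounded_linear_divide bounded_linear_const_mult bounded_linear_add bounded_linear_fst bounded_linear_snd bounded_linear_compose[OF bounded_linear_divide])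
    show "?g' \<circ> ?f' = id" using ne by (auto simp: fun_eq_iff divide_simps) (simp add: algebra_simps)
    show "isCont ?g (t, q)" by (intro continuous_intros isCont_prox q)
    show "?f (?g z) = z" if "z \<in> {z. \<bar>snd z\<bar> * M < 1}" for z
      using that prox_eq[of "snd z" "fst z"] by (auto simp: prod_eq_iff)
  qed (use q open_prox_domain in auto)
  from has_derivative_fst[OF this] show ?thesis by simp
qed

text \<open>For \<open>0 < q\<close> and \<open>q * M < 1\<close> this is the supremum over
  \<open>s\<close> of \<open>l (t + s)\<close> minus the square of \<open>s\<close> over
  \<open>2 * q\<close>, that is, the negative of the Moreau envelope of \<open>- l\<close>. Writing
  it through the maximiser keeps the formula meaningful for \<open>q \<le> 0\<close> as
  well.\<close>

definition envelope :: "real \<times> real \<Rightarrow> real" where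
  "envelope z = l (prox z) - snd z / 2 * (l1 (prox z))\<^sup>2"

lemma envelope_measurable [measurable]: "envelope \<in> borel_measurable borel"
  unfolding envelope_def[abs_def]
  by (intro borel_measurable_diff borel_measurable_times borel_measurable_power borel_measurable_divide
      measurable_compose[OF _ l_measurable] measurable_compose[OF _ l1_measurable])
    (auto intro!: borel_measurable_continuous_onI continuous_intros prox_measurable)

text \<open>This is the envelope theorem: the derivative \<open>?p\<close> of \<open>prox\<close>
  enters only multiplied by \<open>1 - q * l2 u\<close>, which cancels its denominator. The gradient
  is thus free of \<open>l2\<close> and can be differentiated once more.\<close>

lemma has_derivative_envelope:
  fixes t q :: real
  assumes q: "\<bar>q\<bar> * M < 1"
  defines "u \<equiv> prox (t, q)"
  shows "(envelope has_derivative (\<lambda>h. l1 u * fst h + (l1 u)\<^sup>2 / 2 * snd h)) (at (t, q))"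
proof -
  have ne: "1 - q * l2 u \<noteq> 0" using jacobian_ge[of q u] q by linarith
  let ?p = "\<lambda>h. (fst h + l1 u * snd h) / (1 - q * l2 u)"
  have P: "(prox has_derivative ?p) (at (t, q))" using has_derivative_prox[OF q, of t] by (simp add: u_def)
  have L: "((\<lambda>z. l (prox z)) has_derivative (\<lambda>h. l1 u * ?p h)) (at (t, q))"
    using has_derivative_compose[OF P, of l "(*) (l1 u)"] l_deriv by (simp add: has_field_derivative_def u_def)
  have L1: "((\<lambda>z. l1 (prox z)) has_derivative (\<lambda>h. l2 u * ?p h)) (at (t, q))"
    using has_derivative_compose[OF P, of l1 "(*) (l2 u)"] l1_deriv by (simp add: has_field_derivative_def u_def)
  have L1sq: "((\<lambda>z. (l1 (prox z))\<^sup>2) has_derivative (\<lambda>h. 2 * l1 u * (l2 u * ?p h))) (at (t, q))"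
    using has_derivative_power[OF L1, of 2] by (simp add: u_def[symmetric] mult_ac)
  have "(envelope has_derivative (\<lambda>h. l1 u * ?p h - (q / 2 * (2 * l1 u * (l2 u * ?p h)) + snd h / 2 * (l1 u)\<^sup>2))) (at (t, q))"
    unfolding envelope_def[abs_def]
    using has_derivative_diff[OF L has_derivative_mult[OF _ L1sq, of "\<lambda>z. snd z / 2" "\<lambda>h. snd h / 2"]]
    by (simp add: u_def[symmetric] bounded_linear_imp_has_derivative bounded_linear_divide bounded_linear_snd bounded_linear_compose[OF bounded_linear_divide])
  moreover have "l1 u * ?p h - (q / 2 * (2 * l1 u * (l2 u * ?p h)) + snd h / 2 * (l1 u)\<^sup>2) = l1 u * fst h + (l1 u)\<^sup>2 / 2 * snd h" for h :: "real \<times> real"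
  proof -
    define p where "p = ?p h"
    have "(1 - q * l2 u) * p = fst h + l1 u * snd h" using ne by (simp add: p_def)
    then have "l1 u * ((1 - q * l2 u) * p) = l1 u * (fst h + l1 u * snd h)" by simp
    then show ?thesis unfolding p_def[symmetric] by (simp add: algebra_simps power2_eq_square)
  qed
  ultimately show ?thesis by simp
qed

text \<open>Expand about the maximiser, writing \<open>s\<close> as \<open>q * ?g\<close> plus a
  deviation \<open>h\<close>. The terms linear in \<open>h\<close> cancel, and
  \<open>q * M < 1\<close> lets the penalty absorb the quadratic term.\<close>

lemma envelope_upper:
  assumes "0 < q" "q * M < 1"
  shows "l (t + s) - s\<^sup>2 / (2 * q) \<le> envelope (t, q)"
proof -
  let ?u = "prox (t, q)" and ?g = "l1 (prox (t, q))"
  define h where "h = s - q * ?g"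
  have u: "?u = t + q * ?g" using prox_eq[of q t] assms by simp
  have "l (t + s) \<le> l ?u + ?g * h + M * h\<^sup>2 / 2"
  proof -
    have "t + s = ?u + h" using u by (simp add: h_def)
    then show ?thesis using l_le_quadratic[of ?u h] by metis
  qed
  moreover have "s\<^sup>2 / (2 * q) = q / 2 * ?g\<^sup>2 + ?g * h + h\<^sup>2 / (2 * q)"
    using assms by (simp add: h_def field_simps power2_eq_square)
  moreover have "M * h\<^sup>2 / 2 \<le> h\<^sup>2 / (2 * q)"
  proof -
    have "(q * M) * h\<^sup>2 \<le> 1 * h\<^sup>2" using assms by (intro mult_right_mono) auto
    then show ?thesis using assms by (simp add: field_simps)
  qed
  ultimately show ?thesis by (simp add: envelope_def)
qed

lemma envelope_attained:
  assumes "0 < q" "q * M < 1"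
  shows "envelope (t, q) = l (t + q * l1 (prox (t, q))) - (q * l1 (prox (t, q)))\<^sup>2 / (2 * q)"
  using prox_eq[of q t] assms by (simp add: envelope_def power2_eq_square)

lemma l1_prox_le:
  assumes "\<bar>q\<bar> * M < 1"
  shows "(1 - \<bar>q\<bar> * M) * \<bar>l1 (prox (t, q))\<bar> \<le> \<bar>l1 t\<bar>"
proof -
  have "prox (t, q) - t = q * l1 (prox (t, q))"
    using prox_eq[OF assms, of t] by linarith
  then have "\<bar>l1 (prox (t, q)) - l1 t\<bar> \<le> M * \<bar>q * l1 (prox (t, q))\<bar>"
    using l1_lipschitz[of "prox (t, q)" t] by metis
  then show ?thesis by (simp add: abs_mult algebra_simps)
qed

text \<open>The step from \<open>t\<close> to \<open>prox (t, q)\<close> has length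
  \<open>\<bar>q\<bar> * \<bar>l1 (prox (t, q))\<bar>\<close>, over which \<open>l1\<close> varies
  by at most \<open>M\<close> times as much. This carries the spread condition, which speaks of
  \<open>l1\<close> at \<open>t\<close>, over to the state.\<close>

lemma l1_prox_ge:
  assumes "\<bar>q\<bar> * M < 1"
  shows "\<bar>l1 t\<bar> \<le> (1 + \<bar>q\<bar> * M) * \<bar>l1 (prox (t, q))\<bar>"
proof -
  have "prox (t, q) - t = q * l1 (prox (t, q))"
    using prox_eq[OF assms, of t] by linarith
  then have "\<bar>l1 (prox (t, q)) - l1 t\<bar> \<le> M * \<bar>q * l1 (prox (t, q))\<bar>"
    using l1_lipschitz[of "prox (t, q)" t] by metis
  then show ?thesis by (simp add: abs_mult algebra_simps)
qed

end

section \<open>Inverse matrices and the quadratic-over-linear term\<close>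

lemma spd_matrix_inv:
  fixes S :: "real ^ 'n ^ 'n"
  assumes S: "S \<in> spd_matrices"
  shows spd_inv_right: "S *v (matrix_inv S *v w) = w"
    and spd_inv_left: "matrix_inv S *v (S *v w) = w"
    and spd_self_adjoint: "(S *v v) \<bullet> w = v \<bullet> (S *v w)"
    and spd_inv_self_adjoint: "(matrix_inv S *v v) \<bullet> w = v \<bullet> (matrix_inv S *v w)"
proof -
  have inj: "v = 0" if "S *v v = 0" for v
    using S that by (force simp: spd_matrices_def)
  then have "invertible S"
    by (auto simp: invertible_left_inverse matrix_left_invertible_ker)
  then have inv: "S ** matrix_inv S = mat 1" "matrix_inv S ** S = mat 1"
    unfolding invertible_def matrix_inv_def by (metis (mono_tags, lifting) someI_ex)+
  then show R: "S *v (matrix_inv S *v w) = w" "matrix_inv S *v (S *v w) = w" for w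
    by (simp_all add: matrix_vector_mul_assoc)
  show sa: "(S *v v) \<bullet> w = v \<bullet> (S *v w)" for v w
    using S dot_lmul_matrix[of v S w] transpose_matrix_vector[of S v] by (auto simp: spd_matrices_def)
  show "(matrix_inv S *v v) \<bullet> w = v \<bullet> (matrix_inv S *v w)"
    using sa[of "matrix_inv S *v v" "matrix_inv S *v w"] by (simp add: R)
qed

text \<open>The norm bound is coercivity of \<open>S\<close> tested at
  \<open>matrix_inv S *v w\<close>, combined with Cauchy-Schwarz. The bound on the inverse form
  avoids eigenvalues: it combines nonnegativity of the form at one residual with its upper bound at
  \<open>w\<close>.\<close>

lemma spd_inv_bounds:
  fixes S :: "real ^ 'n ^ 'n"
  assumes S: "S \<in> spd_matrices" and pos: "0 < a" "0 < b"
    and bounds: "\<forall>v. norm v = 1 \<longrightarrow> a \<le> v \<bullet> (S *v v) \<and> v \<bullet> (S *v v) \<le> b"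
  shows "norm (matrix_inv S *v w) \<le> norm w / a"
    and "(norm w)\<^sup>2 / b \<le> w \<bullet> (matrix_inv S *v w)"
proof -
  note inv = spd_matrix_inv[OF S]
  have ext: "a * (norm v)\<^sup>2 \<le> v \<bullet> (S *v v) \<and> v \<bullet> (S *v v) \<le> b * (norm v)\<^sup>2" for v
  proof (cases "v = 0")
    case False
    define w where "w = v /\<^sub>R norm v"
    have v: "v = norm v *\<^sub>R w" and "norm w = 1" using False by (auto simp: w_def)
    have "v \<bullet> (S *v v) = (norm v)\<^sup>2 * (w \<bullet> (S *v w))"
      by (subst (1 2) v) (simp add: matrix_vector_mult_scaleR power2_eq_square)
    then show ?thesis
      using bounds[rule_format, OF \<open>norm w = 1\<close>] mult_left_mono[of _ _ "(norm v)\<^sup>2"]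
      by (simp add: mult.commute)
  qed simp
  let ?p = "matrix_inv S *v w"
  have "a * (norm ?p)\<^sup>2 \<le> ?p \<bullet> w" using ext[of ?p] by (simp add: inv)
  also have "\<dots> \<le> norm ?p * norm w" by (rule norm_cauchy_schwarz)
  finally have "norm ?p * (a * norm ?p) \<le> norm ?p * norm w" by (simp add: power2_eq_square mult_ac)
  then have "a * norm ?p \<le> norm w"
    by (cases "?p = 0") auto
  then show "norm ?p \<le> norm w / a" using pos by (simp add: field_simps)
  text \<open>Positivity of the form of \<open>S\<close> at the residual of one gradient step of length \<open>1 / b\<close>.\<close>
  define r where "r = ?p - w /\<^sub>R b"
  have "0 \<le> r \<bullet> (S *v r)" using ext[of r] pos by (meson mult_nonneg_nonneg less_imp_le order_trans zero_le_power2)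
  also have "S *v r = w - (S *v w) /\<^sub>R b"
    by (simp add: r_def matrix_vector_mult_diff_distrib matrix_vector_mult_scaleR inv)
  also have "r \<bullet> (w - (S *v w) /\<^sub>R b) = w \<bullet> ?p - 2 * (norm w)\<^sup>2 / b + w \<bullet> (S *v w) / b\<^sup>2"
  proof -
    have "?p \<bullet> (S *v w) = w \<bullet> w" using inv(3)[of ?p w] by (simp add: inv(1))
    moreover have "norm w * norm w = w \<bullet> w" by (simp add: power2_norm_eq_inner flip: power2_eq_square)
    ultimately show ?thesis
      using pos by (simp add: r_def inner_diff inner_commute[of ?p w] power2_norm_eq_inner power2_eq_square field_simps)
  qed
  also have "w \<bullet> (S *v w) / b\<^sup>2 \<le> (norm w)\<^sup>2 / b"
    using ext[of w] pos by (simp add: field_simps power2_eq_square)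
  finally show "(norm w)\<^sup>2 / b \<le> w \<bullet> ?p" by simp
qed

definition ratio :: "real \<Rightarrow> real ^ 'n ^ 'n \<Rightarrow> (real ^ 'n) \<times> real \<Rightarrow> real" where
  "ratio s P y = s * (fst y \<bullet> (P *v fst y)) / (2 * snd y)"

definition ratio_grad :: "real \<Rightarrow> real ^ 'n ^ 'n \<Rightarrow> (real ^ 'n) \<times> real \<Rightarrow> (real ^ 'n) \<times> real" where
  "ratio_grad s P y = ((s / snd y) *\<^sub>R (P *v fst y), - (s * (fst y \<bullet> (P *v fst y)) / (2 * (snd y)\<^sup>2)))"

text \<open>The component of a direction off the ray through \<open>y\<close>, along which \<open>ratio\<close> is linear.\<close>

definition transverse :: "('a::real_vector) \<times> real \<Rightarrow> 'a \<times> real \<Rightarrow> 'a" where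
  "transverse y h = fst h - (snd h / snd y) *\<^sub>R fst y"

text \<open>As \<open>ratio\<close> is homogeneous of degree one, its Hessian annihilates the ray
  through \<open>y\<close>; writing it through \<open>transverse\<close> makes this visible.\<close>

definition ratio_hess ::
  "real \<Rightarrow> real ^ 'n ^ 'n \<Rightarrow> (real ^ 'n) \<times> real \<Rightarrow> (real ^ 'n) \<times> real \<Rightarrow> (real ^ 'n) \<times> real" where
  "ratio_hess s P y h = ((s / snd y) *\<^sub>R (P *v transverse y h),
     - (s / (snd y)\<^sup>2 * (transverse y h \<bullet> (P *v fst y))))"

lemma has_derivative_matrix_vector_mult [derivative_intros]:
  fixes P :: "real ^ 'n ^ 'm"
  assumes "(f has_derivative f') F"
  shows "((\<lambda>y. P *v f y) has_derivative (\<lambda>h. P *v f' h)) F"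
  by (rule bounded_linear.has_derivative[OF matrix_vector_mul_bounded_linear assms])

context
  fixes P :: "real ^ 'n ^ 'n" and y :: "(real ^ 'n) \<times> real"
  assumes sym: "\<And>v w. (P *v v) \<bullet> w = v \<bullet> (P *v w)"
    and nz: "snd y \<noteq> 0"
begin

lemma has_derivative_form:
  "((\<lambda>y. fst y \<bullet> (P *v fst y)) has_derivative (\<lambda>h. 2 * (fst h \<bullet> (P *v fst y)))) (at y)"
proof -
  have "((\<lambda>y. fst y \<bullet> (P *v fst y)) has_derivative (\<lambda>h. fst y \<bullet> (P *v fst h) + fst h \<bullet> (P *v fst y))) (at y)"
    by (intro has_derivative_inner has_derivative_matrix_vector_mult has_derivative_fst has_derivative_ident)
  moreover have "fst y \<bullet> (P *v v) = v \<bullet> (P *v fst y)" for v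
    by (metis sym inner_commute)
  ultimately show ?thesis by simp
qed

lemma has_derivative_inverse_snd:
  "((\<lambda>y. inverse (snd y)) has_derivative (\<lambda>h. - (snd h / (snd y)\<^sup>2))) (at y)"
proof -
  have "((\<lambda>y. inverse (snd y)) has_derivative (\<lambda>h. - (inverse (snd y) * snd h * inverse (snd y)))) (at y)"
    using nz by (intro Deriv.has_derivative_inverse has_derivative_snd has_derivative_ident)
  then show ?thesis by (simp add: power2_eq_square divide_inverse mult_ac)
qed

lemma has_derivative_ratio: "(ratio s P has_derivative (\<lambda>h. ratio_grad s P y \<bullet> h)) (at y)"
proof -
  have "((\<lambda>y. s / 2 * ((fst y \<bullet> (P *v fst y)) * inverse (snd y))) has_derivative
     (\<lambda>h. s / 2 * ((fst y \<bullet> (P *v fst y)) * - (snd h / (snd y)\<^sup>2) + 2 * (fst h \<bullet> (P *v fst y)) * inverse (snd y)))) (at y)"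
    by (intro has_derivative_mult_right has_derivative_mult has_derivative_form has_derivative_inverse_snd)
  moreover have "s / 2 * ((fst y \<bullet> (P *v fst y)) * - (snd h / (snd y)\<^sup>2) + 2 * (fst h \<bullet> (P *v fst y)) * inverse (snd y))
     = ratio_grad s P y \<bullet> h" for h
  proof -
    have "ratio_grad s P y \<bullet> h = s / snd y * (fst h \<bullet> (P *v fst y)) - s * (fst y \<bullet> (P *v fst y)) / (2 * (snd y)\<^sup>2) * snd h"
      by (simp add: ratio_grad_def inner_prod_def inner_commute[of _ "fst h"])
    then show ?thesis using nz by (simp add: field_simps)
  qed
  moreover have "ratio s P = (\<lambda>y. s / 2 * ((fst y \<bullet> (P *v fst y)) * inverse (snd y)))"
    unfolding ratio_def[abs_def] divide_inverse inverse_mult_distrib by (simp only: mult_ac)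
  ultimately show ?thesis by simp
qed

lemma has_derivative_ratio_grad: "(ratio_grad s P has_derivative ratio_hess s P y) (at y)"
proof -
  let ?i = "inverse (snd y)" and ?di = "\<lambda>h. - (snd h / (snd y)\<^sup>2)" and ?b = "fst y \<bullet> (P *v fst y)"
  have "((\<lambda>y. ((s * inverse (snd y)) *\<^sub>R (P *v fst y), - s / 2 * ((fst y \<bullet> (P *v fst y)) * (inverse (snd y) * inverse (snd y)))))
     has_derivative (\<lambda>h. ((s * ?i) *\<^sub>R (P *v fst h) + (s * ?di h) *\<^sub>R (P *v fst y),
       - s / 2 * (?b * (?i * ?di h + ?di h * ?i) + 2 * (fst h \<bullet> (P *v fst y)) * (?i * ?i))))) (at y)"
    by (intro has_derivative_Pair has_derivative_scaleR has_derivative_mult_right has_derivative_mult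
        has_derivative_form has_derivative_inverse_snd has_derivative_matrix_vector_mult
        has_derivative_fst has_derivative_ident)
  moreover have "((s * ?i) *\<^sub>R (P *v fst h) + (s * ?di h) *\<^sub>R (P *v fst y),
       - s / 2 * (?b * (?i * ?di h + ?di h * ?i) + 2 * (fst h \<bullet> (P *v fst y)) * (?i * ?i))) = ratio_hess s P y h" for h
  proof (rule prod_eqI)
    show "fst ((s * ?i) *\<^sub>R (P *v fst h) + (s * ?di h) *\<^sub>R (P *v fst y),
       - s / 2 * (?b * (?i * ?di h + ?di h * ?i) + 2 * (fst h \<bullet> (P *v fst y)) * (?i * ?i))) = fst (ratio_hess s P y h)"
      by (simp add: ratio_hess_def transverse_def matrix_vector_mult_diff_distrib matrix_vector_mult_scaleR
          scaleR_diff_right power2_eq_square flip: divide_inverse)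
    show "snd ((s * ?i) *\<^sub>R (P *v fst h) + (s * ?di h) *\<^sub>R (P *v fst y),
       - s / 2 * (?b * (?i * ?di h + ?di h * ?i) + 2 * (fst h \<bullet> (P *v fst y)) * (?i * ?i))) = snd (ratio_hess s P y h)"
      using nz by (simp add: ratio_hess_def transverse_def inner_diff_left field_simps power2_eq_square power3_eq_cube)
  qed
  moreover have "ratio_grad s P = (\<lambda>y. ((s * inverse (snd y)) *\<^sub>R (P *v fst y),
      - s / 2 * ((fst y \<bullet> (P *v fst y)) * (inverse (snd y) * inverse (snd y)))))"
    unfolding ratio_grad_def[abs_def] divide_inverse inverse_mult_distrib power2_eq_square
    by (simp only: mult_ac mult_minus_left mult_minus_right)
  ultimately show ?thesis by simp
qed

text \<open>The second component of the Hessian is exactly the correction that completes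
  \<open>fst k\<close> to \<open>transverse y k\<close>. The resulting form is symmetric, and it is
  nonnegative when \<open>P\<close>, \<open>s\<close> and \<open>snd y\<close> are.\<close>

lemma inner_ratio_hess: "ratio_hess s P y h \<bullet> k = s / snd y * (transverse y h \<bullet> (P *v transverse y k))"
  using nz by (simp add: ratio_hess_def inner_prod_def transverse_def matrix_vector_mult_diff_distrib matrix_vector_mult_scaleR
      inner_diff_left inner_diff_right sym power2_eq_square field_simps)

end

section \<open>Gradient and Hessian of the robust loss\<close>

context smooth_loss
begin

definition state :: "real \<Rightarrow> real ^ 'n ^ 'n \<Rightarrow> real ^ 'n \<Rightarrow> (real ^ 'n) \<times> real \<Rightarrow> real" where
  "state s P x y = prox (fst y \<bullet> x, ratio s P y)"

definition loss_value :: "real \<Rightarrow> real ^ 'n ^ 'n \<Rightarrow> real ^ 'n \<Rightarrow> (real ^ 'n) \<times> real \<Rightarrow> real" where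
  "loss_value s P x y = s * snd y + envelope (fst y \<bullet> x, ratio s P y)"

text \<open>This is the vector \<open>a\<close> of the overview: the derivative of
  \<open>state\<close> in direction \<open>h\<close> is \<open>state_dir s P x y \<bullet> h\<close>
  divided by the Jacobian. The coefficient \<open>D\<close> is \<open>curvature\<close>
  below.\<close>

definition state_dir :: "real \<Rightarrow> real ^ 'n ^ 'n \<Rightarrow> real ^ 'n \<Rightarrow> (real ^ 'n) \<times> real \<Rightarrow> (real ^ 'n) \<times> real" where
  "state_dir s P x y = (x, 0) + l1 (state s P x y) *\<^sub>R ratio_grad s P y"

definition loss_grad :: "real \<Rightarrow> real ^ 'n ^ 'n \<Rightarrow> real ^ 'n \<Rightarrow> (real ^ 'n) \<times> real \<Rightarrow> (real ^ 'n) \<times> real" where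
  "loss_grad s P x y = l1 (state s P x y) *\<^sub>R (x, 0) + ((l1 (state s P x y))\<^sup>2 / 2) *\<^sub>R ratio_grad s P y + (0, s)"

definition curvature :: "real \<Rightarrow> real ^ 'n ^ 'n \<Rightarrow> real ^ 'n \<Rightarrow> (real ^ 'n) \<times> real \<Rightarrow> real" where
  "curvature s P x y = l2 (state s P x y) / (1 - ratio s P y * l2 (state s P x y))"

definition loss_hess ::
  "real \<Rightarrow> real ^ 'n ^ 'n \<Rightarrow> real ^ 'n \<Rightarrow> (real ^ 'n) \<times> real \<Rightarrow> (real ^ 'n) \<times> real \<Rightarrow> (real ^ 'n) \<times> real" where
  "loss_hess s P x y h = (curvature s P x y * (state_dir s P x y \<bullet> h)) *\<^sub>R state_dir s P x y
     + ((l1 (state s P x y))\<^sup>2 / 2) *\<^sub>R ratio_hess s P y h"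

context
  fixes s :: real and P :: "real ^ 'n ^ 'n" and x :: "real ^ 'n" and y :: "(real ^ 'n) \<times> real"
  assumes sym: "\<And>v w. (P *v v) \<bullet> w = v \<bullet> (P *v w)"
    and nz: "snd y \<noteq> 0"
    and small: "\<bar>ratio s P y\<bar> * M < 1"
begin

lemma has_derivative_arg:
  "((\<lambda>y. (fst y \<bullet> x, ratio s P y)) has_derivative (\<lambda>h. (fst h \<bullet> x, ratio_grad s P y \<bullet> h))) (at y)"
  by (rule derivative_eq_intros has_derivative_ratio[OF sym nz] refl | simp)+

lemma has_derivative_l1_state:
  "((\<lambda>y. l1 (state s P x y)) has_derivative (\<lambda>h. curvature s P x y * (state_dir s P x y \<bullet> h))) (at y)"
proof -
  let ?u = "state s P x y"
  have "((\<lambda>y. state s P x y) has_derivative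
     (\<lambda>h. (fst h \<bullet> x + l1 ?u * (ratio_grad s P y \<bullet> h)) / (1 - ratio s P y * l2 ?u))) (at y)"
    using has_derivative_compose[OF has_derivative_arg has_derivative_prox[OF small]]
    by (simp add: state_def)
  from has_derivative_compose[OF this, of l1 "(*) (l2 ?u)"] l1_deriv[of ?u]
  have "((\<lambda>y. l1 (state s P x y)) has_derivative
     (\<lambda>h. l2 ?u * ((fst h \<bullet> x + l1 ?u * (ratio_grad s P y \<bullet> h)) / (1 - ratio s P y * l2 ?u)))) (at y)"
    by (simp add: has_field_derivative_def)
  then show ?thesis
    by (simp add: curvature_def state_dir_def inner_add_left inner_commute[of x] inner_prod_def algebra_simps add_divide_distrib)
qed

lemma has_derivative_loss_value: "(loss_value s P x has_derivative (\<lambda>h. loss_grad s P x y \<bullet> h)) (at y)"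
proof -
  let ?u = "state s P x y"
  have "((\<lambda>y. envelope (fst y \<bullet> x, ratio s P y)) has_derivative
     (\<lambda>h. l1 ?u * (fst h \<bullet> x) + (l1 ?u)\<^sup>2 / 2 * (ratio_grad s P y \<bullet> h))) (at y)"
    using has_derivative_compose[OF has_derivative_arg has_derivative_envelope[OF small]]
    by (simp add: state_def)
  from has_derivative_add[OF has_derivative_mult_right[OF has_derivative_snd[OF has_derivative_ident]] this, of s]
  show ?thesis
    by (simp add: loss_value_def[abs_def] loss_grad_def inner_add_left inner_commute[of x] inner_prod_def algebra_simps add_divide_distrib)
qed

text \<open>Differentiating the two occurrences of \<open>l1\<close> gives the same scalar
  \<open>?D h\<close> times \<open>(x, 0)\<close> and times
  \<open>l1 ?u *\<^sub>R ratio_grad s P y\<close>. Their sum is a multiple of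
  \<open>state_dir\<close>, whence the rank-one term.\<close>

lemma has_derivative_loss_grad: "(loss_grad s P x has_derivative loss_hess s P x y) (at y)"
proof -
  let ?u = "state s P x y" and ?D = "\<lambda>h. curvature s P x y * (state_dir s P x y \<bullet> h)"
  have sq: "((\<lambda>y. (l1 (state s P x y))\<^sup>2 / 2) has_derivative (\<lambda>h. l1 ?u * ?D h)) (at y)"
    using bounded_linear.has_derivative[OF bounded_linear_divide has_derivative_power[OF has_derivative_l1_state, of 2], of 2]
    by (simp add: mult_ac)
  have "((\<lambda>y. l1 (state s P x y) *\<^sub>R (x, 0) + ((l1 (state s P x y))\<^sup>2 / 2) *\<^sub>R ratio_grad s P y + (0, s))
     has_derivative (\<lambda>h. ?D h *\<^sub>R (x, 0) + (((l1 ?u)\<^sup>2 / 2) *\<^sub>R ratio_hess s P y h + (l1 ?u * ?D h) *\<^sub>R ratio_grad s P y) + 0)) (at y)"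
    by (intro has_derivative_add has_derivative_scaleR sq has_derivative_ratio_grad[OF sym nz]
        has_derivative_scaleR_left has_derivative_l1_state has_derivative_const)
  moreover have "?D h *\<^sub>R (x, 0) + (((l1 ?u)\<^sup>2 / 2) *\<^sub>R ratio_hess s P y h + (l1 ?u * ?D h) *\<^sub>R ratio_grad s P y) + 0
     = loss_hess s P x y h" for h
  proof -
    have "loss_hess s P x y h = ?D h *\<^sub>R ((x, 0) + l1 ?u *\<^sub>R ratio_grad s P y) + ((l1 ?u)\<^sup>2 / 2) *\<^sub>R ratio_hess s P y h"
      by (simp add: loss_hess_def state_dir_def)
    then show ?thesis by (simp only: scaleR_add_right scaleR_scaleR mult.commute ac_simps add_0)
  qed
  ultimately show ?thesis by (simp add: loss_grad_def[abs_def])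
qed

lemma inner_loss_hess:
  "loss_hess s P x y h \<bullet> k = curvature s P x y * (state_dir s P x y \<bullet> h) * (state_dir s P x y \<bullet> k)
     + (l1 (state s P x y))\<^sup>2 / 2 * (s / snd y * (transverse y h \<bullet> (P *v transverse y k)))"
  by (simp add: loss_hess_def inner_add_left inner_ratio_hess[OF sym nz])

text \<open>Along the ray through \<open>y\<close>, homogeneity of \<open>ratio\<close> and the
  fixed point equation of \<open>prox\<close> reproduce the state itself. What remains is linear in
  the transverse part.\<close>

lemma state_dir_inner:
  "state_dir s P x y \<bullet> h = snd h / snd y * state s P x y
     + transverse y h \<bullet> (x + (l1 (state s P x y) * s / snd y) *\<^sub>R (P *v fst y))"
proof -
  have u: "state s P x y = fst y \<bullet> x + ratio s P y * l1 (state s P x y)"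
    unfolding state_def by (rule prox_eq[OF small])
  have "state_dir s P x y \<bullet> h = snd h / snd y * (fst y \<bullet> x + ratio s P y * l1 (state s P x y))
     + transverse y h \<bullet> (x + (l1 (state s P x y) * s / snd y) *\<^sub>R (P *v fst y))"
    using nz by (simp add: state_dir_def ratio_grad_def ratio_def transverse_def inner_prod_def inner_add_left inner_add_right
        inner_diff_left inner_commute[of x] inner_commute[of "P *v _"] power2_eq_square field_simps)
  then show ?thesis using u by simp
qed

end

text \<open>The substitution of \<open>\<gamma> * sqrt \<delta> * b\<close> for the shift turns the
  penalty in \<open>\<gamma>\<close> into the quadratic penalty of the envelope with parameter
  \<open>q\<close>.\<close>

lemma robust_loss_eq:
  assumes pos: "0 < \<delta>" "0 < lam" "0 < \<beta> \<bullet> (matrix_inv (A x) *v \<beta>)"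
    and small: "ratio (sqrt \<delta>) (matrix_inv (A x)) (\<beta>, lam) * M < 1"
  shows "robust_loss l A \<delta> \<beta> lam x = ereal (loss_value (sqrt \<delta>) (matrix_inv (A x)) x (\<beta>, lam))"
proof -
  define b where "b = \<beta> \<bullet> (matrix_inv (A x) *v \<beta>)"
  define q where "q = ratio (sqrt \<delta>) (matrix_inv (A x)) (\<beta>, lam)"
  define e where "e = envelope (\<beta> \<bullet> x, q)"
  have q: "q = sqrt \<delta> * b / (2 * lam)" by (simp add: q_def ratio_def b_def)
  have qp: "0 < q" using pos by (simp add: q b_def)
  have val: "loss_value (sqrt \<delta>) (matrix_inv (A x)) x (\<beta>, lam) = sqrt \<delta> * lam + e"
    by (simp add: loss_value_def e_def q_def)
  have obj: "dual_objective l A \<delta> \<gamma> \<beta> lam x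
      = sqrt \<delta> * lam + (l (\<beta> \<bullet> x + \<gamma> * sqrt \<delta> * b) - (\<gamma> * sqrt \<delta> * b)\<^sup>2 / (2 * q))" for \<gamma>
  proof -
    have "(\<gamma> * sqrt \<delta> * b)\<^sup>2 / (2 * q) = lam * sqrt \<delta> * (\<gamma>\<^sup>2 * b)"
      using pos by (simp add: q b_def[symmetric] power2_eq_square field_simps)
    then show ?thesis by (simp add: dual_objective_def b_def[symmetric] algebra_simps)
  qed
  show ?thesis unfolding robust_loss_def val
  proof (rule antisym)
    show "(SUP \<gamma>. ereal (dual_objective l A \<delta> \<gamma> \<beta> lam x)) \<le> ereal (sqrt \<delta> * lam + e)"
      using envelope_upper[OF qp] small by (intro SUP_least) (simp add: obj e_def q_def)
    define g where "g = l1 (prox (\<beta> \<bullet> x, q))"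
    \<comment> \<open>The maximising shift is \<open>q * g\<close>; solving for the dual variable
      gives \<open>g / (2 * lam)\<close>.\<close>
    have "(g / (2 * lam)) * sqrt \<delta> * b = q * g" by (simp add: q)
    then have "dual_objective l A \<delta> (g / (2 * lam)) \<beta> lam x = sqrt \<delta> * lam + e"
      using envelope_attained[OF qp, of "\<beta> \<bullet> x"] small by (simp only: obj e_def g_def q_def)
    then show "ereal (sqrt \<delta> * lam + e) \<le> (SUP \<gamma>. ereal (dual_objective l A \<delta> \<gamma> \<beta> lam x))"
      by (intro SUP_upper2[of "g / (2 * lam)"]) auto
  qed
qed

end

section \<open>Norm bounds and quadratic growth in the data point\<close>

lemma norm_transverse_le:
  fixes y h :: "('a::real_normed_vector) \<times> real"
  assumes "0 < m" "m \<le> snd y" "norm (fst y) \<le> R"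
  shows "norm (transverse y h) \<le> (1 + R / m) * norm h"
proof -
  have "norm (transverse y h) \<le> norm (fst h) + \<bar>snd h\<bar> * (norm (fst y) / snd y)"
    using norm_triangle_ineq4[of "fst h" "(snd h / snd y) *\<^sub>R fst y"] assms
    by (simp add: transverse_def)
  also have "\<dots> \<le> norm h + norm h * (R / m)"
    using assms norm_fst_le[of "fst h" "snd h"] norm_snd_le[of "snd h" "fst h"]
    by (intro add_mono mult_mono frac_le) (auto intro: order_trans[OF norm_ge_zero])
  finally show ?thesis by (simp add: algebra_simps)
qed

lemma norm_ratio_grad_le:
  assumes P: "\<And>v. norm (P *v v) \<le> c * norm v" and "0 \<le> s" "0 \<le> c" "0 < m" "m \<le> snd y" "norm (fst y) \<le> R"
  shows "norm (ratio_grad s P y) \<le> s / m * (c * R) + s * (R * (c * R)) / (2 * m\<^sup>2)"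
proof -
  have R: "0 \<le> R" using assms(6) norm_ge_zero order_trans by blast
  have Py: "norm (P *v fst y) \<le> c * R"
    using P[of "fst y"] mult_left_mono[OF assms(6,3)] by linarith
  have "\<bar>fst y \<bullet> (P *v fst y)\<bar> \<le> R * (c * R)"
    by (rule order_trans[OF Cauchy_Schwarz_ineq2 mult_mono]) (use Py assms R in auto)
  then have "\<bar>s * (fst y \<bullet> (P *v fst y)) / (2 * (snd y)\<^sup>2)\<bar> \<le> s * (R * (c * R)) / (2 * m\<^sup>2)"
    using assms R by (auto simp: abs_mult intro!: frac_le mult_mono power_mono)
  moreover have "norm ((s / snd y) *\<^sub>R (P *v fst y)) \<le> s / m * (c * R)"
    using assms R Py by (auto intro!: mult_mono frac_le)
  ultimately show ?thesis
    using norm_Pair_le[of "(s / snd y) *\<^sub>R (P *v fst y)" "- (s * (fst y \<bullet> (P *v fst y)) / (2 * (snd y)\<^sup>2))"]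
    by (simp add: ratio_grad_def)
qed

lemma norm_ratio_hess_le:
  assumes P: "\<And>v. norm (P *v v) \<le> c * norm v" and "0 \<le> s" "0 \<le> c" "0 < m" "m \<le> snd y" "norm (fst y) \<le> R"
  shows "norm (ratio_hess s P y h) \<le> (s / m * c + s / m\<^sup>2 * (c * R)) * ((1 + R / m) * norm h)"
proof -
  let ?w = "transverse y h"
  have R: "0 \<le> R" using assms(6) norm_ge_zero order_trans by blast
  have Py: "norm (P *v fst y) \<le> c * R"
    using P[of "fst y"] mult_left_mono[OF assms(6,3)] by linarith
  have "\<bar>?w \<bullet> (P *v fst y)\<bar> \<le> norm ?w * (c * R)"
    by (rule order_trans[OF Cauchy_Schwarz_ineq2 mult_mono]) (use Py assms R in auto)
  then have "\<bar>s / (snd y)\<^sup>2 * (?w \<bullet> (P *v fst y))\<bar> \<le> s / m\<^sup>2 * (norm ?w * (c * R))"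
    using assms R by (auto simp only: abs_mult abs_divide intro!: frac_le mult_mono power_mono) auto
  moreover have "norm ((s / snd y) *\<^sub>R (P *v ?w)) \<le> s / m * (c * norm ?w)"
    using assms by (auto intro!: mult_mono frac_le)
  ultimately have "norm (ratio_hess s P y h) \<le> s / m * (c * norm ?w) + s / m\<^sup>2 * (norm ?w * (c * R))"
    using norm_Pair_le[of "(s / snd y) *\<^sub>R (P *v ?w)" "- (s / (snd y)\<^sup>2 * (?w \<bullet> (P *v fst y)))"]
    by (simp add: ratio_hess_def)
  also have "\<dots> = (s / m * c + s / m\<^sup>2 * (c * R)) * norm ?w" by (simp add: algebra_simps)
  also have "\<dots> \<le> (s / m * c + s / m\<^sup>2 * (c * R)) * ((1 + R / m) * norm h)"
    using assms R norm_transverse_le[OF assms(4-6)] by (intro mult_left_mono) auto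
  finally show ?thesis .
qed

context smooth_loss
begin

lemma l1_state_le:
  assumes "\<bar>ratio s P y\<bar> * M \<le> \<kappa>" "\<kappa> < 1" "norm (fst y) \<le> R" "norm x \<le> X"
  shows "\<bar>l1 (state s P x y)\<bar> \<le> (\<bar>l1 0\<bar> + M * (R * X)) / (1 - \<kappa>)"
proof -
  let ?g = "l1 (state s P x y)"
  have R: "0 \<le> R" using assms(3) norm_ge_zero order_trans by blast
  have "(1 - \<kappa>) * \<bar>?g\<bar> \<le> (1 - \<bar>ratio s P y\<bar> * M) * \<bar>?g\<bar>"
    using assms by (intro mult_right_mono) auto
  also have "\<dots> \<le> \<bar>l1 (fst y \<bullet> x)\<bar>"
    using assms by (auto simp: state_def intro!: l1_prox_le)
  also have "\<dots> \<le> \<bar>l1 0\<bar> + M * \<bar>fst y \<bullet> x\<bar>"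
    using l1_lipschitz[of "fst y \<bullet> x" 0] by simp
  also have "\<bar>fst y \<bullet> x\<bar> \<le> R * X"
    by (rule order_trans[OF Cauchy_Schwarz_ineq2 mult_mono]) (use assms R in auto)
  finally show ?thesis using assms M_pos by (simp add: field_simps)
qed

lemma curvature_bounds:
  assumes "\<bar>ratio s P y\<bar> * M \<le> \<kappa>" "\<kappa> < 1"
  shows "0 \<le> curvature s P x y" and "curvature s P x y \<le> M / (1 - \<kappa>)"
  using jacobian_ge[of "ratio s P y" "state s P x y"] l2_nonneg[of "state s P x y"] l2_le[of "state s P x y"] assms
  by (auto simp: curvature_def intro!: frac_le divide_nonneg_nonneg)

text \<open>Both \<open>state\<close> and its \<open>l1\<close> value grow at most linearly in
  \<open>x\<close>, and the three quantities are at most quadratic in them. The constant is common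
  to all admissible \<open>P\<close>, \<open>x\<close> and \<open>y\<close>, so it provides the
  integrable dominating function for differentiation under the integral.\<close>

lemma growth_bounds:
  fixes s c m \<Lambda> R \<kappa> :: real
  assumes "0 \<le> s" "0 \<le> c" "0 < m" "0 \<le> R" "0 \<le> \<kappa>" "\<kappa> < 1"
  obtains C where
    "\<And>(P :: real ^ 'n ^ 'n) x y. \<lbrakk>\<And>v. norm (P *v v) \<le> c * norm v; m \<le> snd y; snd y \<le> \<Lambda>; norm (fst y) \<le> R;
       \<bar>ratio s P y\<bar> * M \<le> \<kappa>\<rbrakk> \<Longrightarrow>
       \<bar>loss_value s P x y\<bar> \<le> C * (1 + norm x)\<^sup>2 \<and> norm (loss_grad s P x y) \<le> C * (1 + norm x)\<^sup>2 \<and>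
       (\<forall>h. norm (loss_hess s P x y h) \<le> C * (1 + norm x)\<^sup>2 * norm h)"
proof -
  \<comment> \<open>With \<open>X = 1 + norm x\<close>, \<open>Cg\<close>, \<open>Cu\<close> and
    \<open>Cs\<close> bound \<open>l1\<close> at the state, the state and \<open>state_dir\<close>
    as multiples of \<open>X\<close>. \<open>Cr\<close>, \<open>Ch\<close> and \<open>Cc\<close>
    bound \<open>ratio_grad\<close>, \<open>ratio_hess\<close> (per unit direction) and
    \<open>curvature\<close>. \<open>C1\<close>, \<open>C2\<close> and \<open>C3\<close> belong to
    value, gradient and Hessian.\<close>
  define Cg where "Cg = (\<bar>l1 0\<bar> + M * R) / (1 - \<kappa>)"
  define Cr where "Cr = s / m * (c * R) + s * (R * (c * R)) / (2 * m\<^sup>2)"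
  define Ch where "Ch = (s / m * c + s / m\<^sup>2 * (c * R)) * (1 + R / m)"
  define Cu where "Cu = R + \<kappa> / M * Cg"
  define C1 where "C1 = s * \<bar>\<Lambda>\<bar> + (\<bar>l 0\<bar> + \<bar>l1 0\<bar> * Cu + M * Cu\<^sup>2 + \<kappa> / M / 2 * Cg\<^sup>2)"
  define C2 where "C2 = Cg + Cg\<^sup>2 / 2 * Cr + s"
  define Cc where "Cc = M / (1 - \<kappa>)"
  define Cs where "Cs = 1 + Cg * Cr"
  define C3 where "C3 = Cc * Cs\<^sup>2 + Cg\<^sup>2 / 2 * Ch"
  have nn: "0 \<le> Cg" "0 \<le> Cr" "0 \<le> Ch" "0 \<le> Cu" "0 \<le> Cc" "0 \<le> Cs"
    using assms M_pos by (auto simp: Cg_def Cr_def Ch_def Cu_def Cc_def Cs_def)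
  then have nn': "0 \<le> C1" "0 \<le> C2" "0 \<le> C3"
    using assms M_pos by (auto simp: C1_def C2_def C3_def)
  show thesis
  proof (rule that[of "C1 + C2 + C3"])
    fix P :: "real ^ 'n ^ 'n" and x y
    assume P: "\<And>v. norm (P *v v) \<le> c * norm v" and y: "m \<le> snd y" "snd y \<le> \<Lambda>" "norm (fst y) \<le> R"
      and small: "\<bar>ratio s P y\<bar> * M \<le> \<kappa>"
    let ?u = "state s P x y" and ?q = "ratio s P y"
    define g where "g = \<bar>l1 ?u\<bar>"
    define X where "X = 1 + norm x"
    have X: "1 \<le> X" "norm x \<le> X" by (auto simp: X_def)
    then have XX: "X \<le> X\<^sup>2" using mult_left_mono[of 1 X X] by (simp add: power2_eq_square)
    \<comment> \<open>Since \<open>1 \<le> X\<close>, lower powers of \<open>X\<close> are absorbed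
      into the square.\<close>
    have up: "a \<le> a * X\<^sup>2" "a * X \<le> a * X\<^sup>2" if "0 \<le> a" for a
      using X XX that mult_left_mono[of 1 "X\<^sup>2" a] by (auto intro: mult_left_mono)
    have g: "0 \<le> g" "g \<le> Cg * X"
    proof -
      have "g \<le> (\<bar>l1 0\<bar> + M * (R * X)) / (1 - \<kappa>)"
        unfolding g_def by (rule l1_state_le[OF small assms(6) y(3) X(2)])
      also have "\<dots> \<le> (\<bar>l1 0\<bar> * X + M * (R * X)) / (1 - \<kappa>)"
        using assms X by (intro divide_right_mono add_mono) (auto simp: mult_le_cancel_left1)
      finally show "g \<le> Cg * X" by (simp add: Cg_def algebra_simps add_divide_distrib)
    qed (simp add: g_def)
    have g2: "(l1 ?u)\<^sup>2 \<le> Cg\<^sup>2 * X\<^sup>2"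
      using power_mono[OF g(2,1), of 2] by (simp add: g_def power_mult_distrib)
    have rg: "norm (ratio_grad s P y) \<le> Cr"
      unfolding Cr_def by (rule norm_ratio_grad_le[OF P assms(1-3) y(1,3)])
    have q: "\<bar>?q\<bar> \<le> \<kappa> / M" using small M_pos by (simp add: field_simps)
    have u: "\<bar>?u\<bar> \<le> Cu * X"
    proof -
      have "?u = fst y \<bullet> x + ?q * l1 ?u"
        unfolding state_def by (rule prox_eq) (use small assms in simp)
      then have "\<bar>?u\<bar> \<le> \<bar>fst y \<bullet> x\<bar> + \<bar>?q\<bar> * g"
        using abs_triangle_ineq[of "fst y \<bullet> x" "?q * l1 ?u"] unfolding g_def abs_mult[symmetric] by presburger
      also have "\<dots> \<le> R * X + \<kappa> / M * (Cg * X)"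
        using y X assms g M_pos q by (intro add_mono order_trans[OF Cauchy_Schwarz_ineq2 mult_mono] mult_mono) auto
      finally show ?thesis by (simp add: Cu_def algebra_simps)
    qed
    have v: "\<bar>loss_value s P x y\<bar> \<le> C1 * X\<^sup>2"
    proof -
      have "\<bar>loss_value s P x y\<bar> \<le> \<bar>s * snd y\<bar> + (\<bar>l ?u\<bar> + \<bar>?q / 2 * (l1 ?u)\<^sup>2\<bar>)"
        by (simp add: loss_value_def envelope_def state_def)
      also have "\<bar>s * snd y\<bar> \<le> s * \<bar>\<Lambda>\<bar>" using y assms by (simp add: abs_mult mult_left_mono)
      also have "s * \<bar>\<Lambda>\<bar> \<le> s * \<bar>\<Lambda>\<bar> * X\<^sup>2" using assms by (intro up) auto
      also have "\<bar>l ?u\<bar> \<le> \<bar>l 0\<bar> * X\<^sup>2 + \<bar>l1 0\<bar> * Cu * X\<^sup>2 + M * Cu\<^sup>2 * X\<^sup>2"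
      proof -
        have "\<bar>l1 0\<bar> * \<bar>?u\<bar> \<le> \<bar>l1 0\<bar> * (Cu * X)" using u by (intro mult_left_mono) auto
        also have "\<dots> \<le> \<bar>l1 0\<bar> * Cu * X\<^sup>2" using up(2)[of "\<bar>l1 0\<bar> * Cu"] nn by (simp add: mult.assoc)
        finally have "\<bar>l1 0\<bar> * \<bar>?u\<bar> \<le> \<bar>l1 0\<bar> * Cu * X\<^sup>2" .
        moreover have "M * ?u\<^sup>2 \<le> M * Cu\<^sup>2 * X\<^sup>2"
          using power_mono[OF u, of 2] M_pos by (simp add: power_mult_distrib mult_left_mono)
        moreover have "\<bar>l 0\<bar> \<le> \<bar>l 0\<bar> * X\<^sup>2" by (rule up) simp
        ultimately show ?thesis using l_abs_le[of ?u] by linarith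
      qed
      also have "\<bar>?q / 2 * (l1 ?u)\<^sup>2\<bar> \<le> \<kappa> / M / 2 * (Cg\<^sup>2 * X\<^sup>2)"
        using q g2 assms M_pos unfolding abs_mult by (intro mult_mono) auto
      finally show ?thesis by (simp add: C1_def algebra_simps)
    qed
    have gr: "norm (loss_grad s P x y) \<le> C2 * X\<^sup>2"
    proof -
      have "norm (loss_grad s P x y) \<le> g * norm x + (l1 ?u)\<^sup>2 / 2 * norm (ratio_grad s P y) + s"
        unfolding loss_grad_def g_def
        by (intro order_trans[OF norm_triangle_ineq] add_mono) (use assms in \<open>auto simp: norm_Pair\<close>)
      also have "\<dots> \<le> (Cg * X) * X + (Cg\<^sup>2 * X\<^sup>2) / 2 * Cr + s * X\<^sup>2"
        using g X rg g2 nn assms by (intro add_mono mult_mono divide_right_mono up) auto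
      finally show ?thesis by (simp add: C2_def algebra_simps power2_eq_square)
    qed
    have he: "norm (loss_hess s P x y h) \<le> C3 * X\<^sup>2 * norm h" for h
    proof -
      have st: "norm (state_dir s P x y) \<le> Cs * X"
      proof -
        have "norm (state_dir s P x y) \<le> norm x + g * norm (ratio_grad s P y)"
          unfolding state_dir_def g_def
          by (intro order_trans[OF norm_triangle_ineq] add_mono) (auto simp: norm_Pair)
        also have "\<dots> \<le> X + (Cg * X) * Cr" using X g rg nn by (intro add_mono mult_mono) auto
        finally show ?thesis by (simp add: Cs_def algebra_simps)
      qed
      have "norm (loss_hess s P x y h)
          \<le> norm ((curvature s P x y * (state_dir s P x y \<bullet> h)) *\<^sub>R state_dir s P x y)
            + norm (((l1 ?u)\<^sup>2 / 2) *\<^sub>R ratio_hess s P y h)"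
        unfolding loss_hess_def by (rule norm_triangle_ineq)
      also have "norm ((curvature s P x y * (state_dir s P x y \<bullet> h)) *\<^sub>R state_dir s P x y)
          \<le> Cc * (Cs * X * norm h) * (Cs * X)"
        unfolding norm_scaleR abs_mult
        using curvature_bounds[OF small assms(6), of x, folded Cc_def] st nn X M_pos assms
        by (intro mult_mono order_trans[OF Cauchy_Schwarz_ineq2]) auto
      also have "norm (((l1 ?u)\<^sup>2 / 2) *\<^sub>R ratio_hess s P y h) \<le> Cg\<^sup>2 * X\<^sup>2 / 2 * (Ch * norm h)"
        unfolding norm_scaleR
        using norm_ratio_hess_le[OF P assms(1-3) y(1,3), of h] g2
        by (intro mult_mono) (auto simp: Ch_def mult.assoc)
      finally show ?thesis by (simp add: C3_def algebra_simps power2_eq_square)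
    qed
    have le: "a * X\<^sup>2 \<le> (C1 + C2 + C3) * X\<^sup>2" if "a \<le> C1 + C2 + C3" for a
      using that by (rule mult_right_mono) simp
    have "\<bar>loss_value s P x y\<bar> \<le> (C1 + C2 + C3) * X\<^sup>2"
      by (rule order_trans[OF v le]) (use nn' in simp)
    moreover have "norm (loss_grad s P x y) \<le> (C1 + C2 + C3) * X\<^sup>2"
      by (rule order_trans[OF gr le]) (use nn' in simp)
    moreover have "norm (loss_hess s P x y h) \<le> (C1 + C2 + C3) * X\<^sup>2 * norm h" for h
      by (rule order_trans[OF he mult_right_mono[OF le]]) (use nn' in auto)
    ultimately show "\<bar>loss_value s P x y\<bar> \<le> (C1 + C2 + C3) * (1 + norm x)\<^sup>2 \<and> norm (loss_grad s P x y) \<le> (C1 + C2 + C3) * (1 + norm x)\<^sup>2 \<and>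
       (\<forall>h. norm (loss_hess s P x y h) \<le> (C1 + C2 + C3) * (1 + norm x)\<^sup>2 * norm h)"
      unfolding X_def[symmetric] by blast
  qed
qed

lemma loss_measurable:
  fixes P :: "real ^ 'n \<Rightarrow> real ^ 'n ^ 'n"
  assumes P: "\<And>v. (\<lambda>x. P x *v v) \<in> borel_measurable borel"
  shows "(\<lambda>x. loss_value s (P x) x y) \<in> borel_measurable borel"
    and "(\<lambda>x. loss_grad s (P x) x y) \<in> borel_measurable borel"
    and "(\<lambda>x. loss_hess s (P x) x y h) \<in> borel_measurable borel"
proof -
  note [measurable] = P
  have id [measurable]: "(\<lambda>x :: real ^ 'n. x) \<in> borel_measurable borel" by simp
  have q [measurable]: "(\<lambda>x. ratio s (P x) y) \<in> borel_measurable borel"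
    unfolding ratio_def by measurable
  have arg: "(\<lambda>x. (fst y \<bullet> x, ratio s (P x) y)) \<in> borel_measurable borel"
    by (intro borel_measurable_Pair) measurable
  have u [measurable]: "(\<lambda>x. state s (P x) x y) \<in> borel_measurable borel"
    unfolding state_def by (rule measurable_compose[OF arg prox_measurable])
  show "(\<lambda>x. loss_value s (P x) x y) \<in> borel_measurable borel"
    unfolding loss_value_def
    by (intro borel_measurable_add borel_measurable_const measurable_compose[OF arg envelope_measurable])
  have rg [measurable]: "(\<lambda>x. ratio_grad s (P x) y) \<in> borel_measurable borel"
    unfolding ratio_grad_def by (intro borel_measurable_Pair) measurable
  have rh [measurable]: "(\<lambda>x. ratio_hess s (P x) y h) \<in> borel_measurable borel"
    unfolding ratio_hess_def by (intro borel_measurable_Pair) measurable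
  have x0 [measurable]: "(\<lambda>x :: real ^ 'n. (x, 0 :: real)) \<in> borel_measurable borel"
    by (intro borel_measurable_Pair) measurable
  show "(\<lambda>x. loss_grad s (P x) x y) \<in> borel_measurable borel"
    unfolding loss_grad_def by measurable
  have st [measurable]: "(\<lambda>x. state_dir s (P x) x y) \<in> borel_measurable borel"
    unfolding state_dir_def by measurable
  show "(\<lambda>x. loss_hess s (P x) x y h) \<in> borel_measurable borel"
    unfolding loss_hess_def curvature_def by measurable
qed

end

section \<open>The Hessian of the robust objective\<close>

lemma ereal_expectation_ereal:
  assumes "integrable N f"
  shows "ereal_expectation N (\<lambda>x. ereal (f x)) = ereal (\<integral>x. f x \<partial>N)"
proof -
  have fin: "(\<integral>\<^sup>+x. ennreal (f x) \<partial>N) < \<infinity>" "(\<integral>\<^sup>+x. ennreal (- f x) \<partial>N) < \<infinity>"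
    using assms by (auto simp: real_integrable_def less_top)
  have e: "enn2ereal a = ereal (enn2real a)" if "a < \<infinity>" for a
    using that by (cases a) auto
  show ?thesis
    using fin by (simp add: ereal_expectation_def real_lebesgue_integral_def[OF assms] e)
qed

lemma ereal_expectation_cong_AE:
  assumes "AE x in N. f x = g x"
  shows "ereal_expectation N f = ereal_expectation N g"
proof -
  have "(\<integral>\<^sup>+x. e2ennreal (f x) \<partial>N) = (\<integral>\<^sup>+x. e2ennreal (g x) \<partial>N)"
    "(\<integral>\<^sup>+x. e2ennreal (- f x) \<partial>N) = (\<integral>\<^sup>+x. e2ennreal (- g x) \<partial>N)"
    by (rule nn_integral_cong_AE, use assms in eventually_elim, simp)+
  then show ?thesis by (simp add: ereal_expectation_def)
qed

text \<open>Along the pairs \<open>(x, x - v)\<close> the cost is the form of \<open>A x\<close> at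
  the fixed vector \<open>v\<close>. That form is therefore lower semicontinuous in
  \<open>x\<close>, hence Borel, and polarisation recovers the entries of the symmetric
  matrix.\<close>

lemma matrix_entry_measurable:
  fixes A :: "real ^ 'n \<Rightarrow> real ^ 'n ^ 'n"
  assumes spd: "\<And>x. A x \<in> spd_matrices"
    and lsc: "lower_semicontinuous (\<lambda>(x, x'). transport_cost A x x')"
  shows "(\<lambda>x. A x $ i $ j) \<in> borel_measurable borel"
proof -
  have form [measurable]: "(\<lambda>x. v \<bullet> (A x *v v)) \<in> borel_measurable borel" for v
    unfolding borel_measurable_iff_greater
  proof
    fix r
    have "open {x. r < v \<bullet> (A x *v v)}"
    proof (subst open_subopen, rule ballI)
      fix x assume "x \<in> {x. r < v \<bullet> (A x *v v)}"
      then have "\<forall>\<^sub>F z in nhds (x, x - v). r < (case z of (x, x') \<Rightarrow> transport_cost A x x')"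
        by (intro lsc[unfolded lower_semicontinuous_def, rule_format]) (simp add: transport_cost_def)
      moreover have "filterlim (\<lambda>x. (x, x - v)) (nhds (x, x - v)) (nhds x)"
        by (intro tendsto_intros filterlim_ident)
      ultimately have "\<forall>\<^sub>F z in nhds x. r < (case (z, z - v) of (x, x') \<Rightarrow> transport_cost A x x')"
        by (rule eventually_compose_filterlim)
      then have "\<forall>\<^sub>F x in nhds x. r < v \<bullet> (A x *v v)"
        by eventually_elim (simp add: transport_cost_def)
      then show "\<exists>T. open T \<and> x \<in> T \<and> T \<subseteq> {x. r < v \<bullet> (A x *v v)}"
        unfolding eventually_nhds subset_iff mem_Collect_eq by blast
    qed
    then show "{w \<in> space borel. r < v \<bullet> (A w *v v)} \<in> sets borel" by simp
  qed
  have "A x $ i $ j = ((axis i 1 + axis j 1) \<bullet> (A x *v (axis i 1 + axis j 1))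
      - axis i 1 \<bullet> (A x *v axis i 1) - axis j 1 \<bullet> (A x *v axis j 1)) / 2" for x
  proof -
    have "axis j 1 \<bullet> (A x *v axis i 1) = axis i 1 \<bullet> (A x *v axis j 1)"
      using spd_self_adjoint[OF spd, of x "axis i 1" "axis j 1"] by (simp add: inner_commute)
    moreover have "A x $ i $ j = axis i 1 \<bullet> (A x *v axis j 1)"
      by (simp add: inner_axis' matrix_vector_mult_basis column_def)
    ultimately show ?thesis by (simp add: matrix_vector_right_distrib inner_add_left inner_add_right)
  qed
  then show ?thesis by (simp only:) measurable
qed

lemma borel_measurable_vec_lambda:
  fixes f :: "'a \<Rightarrow> 'n::finite \<Rightarrow> real"
  assumes "\<And>i. (\<lambda>x. f x i) \<in> borel_measurable N"
  shows "(\<lambda>x. \<chi> i. f x i) \<in> borel_measurable N"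
  using assms by (subst borel_measurable_euclidean_space) (auto simp: Basis_vec_def inner_axis)

text \<open>By Cramer's rule the coordinates are quotients of polynomials in the entries of
  \<open>A x\<close>.\<close>

lemma matrix_inv_measurable:
  fixes A :: "real ^ 'n \<Rightarrow> real ^ 'n ^ 'n"
  assumes spd: "\<And>x. A x \<in> spd_matrices"
    and lsc: "lower_semicontinuous (\<lambda>(x, x'). transport_cost A x x')"
  shows "(\<lambda>x. matrix_inv (A x) *v v) \<in> borel_measurable borel"
proof -
  note [measurable] = matrix_entry_measurable[OF spd lsc]
  have "det (A x) \<noteq> 0" for x
  proof -
    have "invertible (A x)"
      unfolding invertible_left_inverse matrix_left_invertible_ker
      by (metis spd_inv_left[OF spd] matrix_vector_mult_0_right)
    then show ?thesis by (simp add: invertible_det_nz)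
  qed
  then have "matrix_inv (A x) *v v = (\<chi> k. det (\<chi> i j. if j = k then v $ i else A x $ i $ j) / det (A x))" for x
    using cramer[of "A x" "matrix_inv (A x) *v v" v] spd_inv_right[OF spd] by blast
  then show ?thesis
    unfolding det_def by (simp only:) (intro borel_measurable_vec_lambda, simp)
qed

context smooth_loss
begin

text \<open>On a ball around \<open>\<theta>\<close> the robust loss equals
  \<open>loss_value\<close> almost surely, with growth bounds uniform in the ball. Its expectation
  is then differentiated twice under the integral: at every point of the ball for the gradient, and
  at \<open>\<theta>\<close> for the Hessian.\<close>

lemma has_hessian_robust_objective:
  fixes A :: "real ^ 'n \<Rightarrow> real ^ 'n ^ 'n" and \<theta> :: "(real ^ 'n) \<times> real"
  assumes borel: "sets N = sets borel"
    and spd: "\<And>x. A x \<in> spd_matrices"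
    and lsc: "lower_semicontinuous (\<lambda>(x, x'). transport_cost A x x')"
    and rho: "0 < \<rho>min" "0 < \<rho>max"
    and bounds: "AE x in N. \<forall>v. norm v = 1 \<longrightarrow> \<rho>min \<le> v \<bullet> (A x *v v) \<and> v \<bullet> (A x *v v) \<le> \<rho>max"
    and moment: "integrable N (\<lambda>x. (1 + norm x)\<^sup>2)"
    and pos: "0 < \<delta>" "fst \<theta> \<noteq> 0" "0 < snd \<theta>"
    and small: "sqrt \<delta> * (norm (fst \<theta>))\<^sup>2 * M < 2 * snd \<theta> * \<rho>min"
  defines "P \<equiv> \<lambda>x. matrix_inv (A x)"
  shows "has_hessian (robust_objective N l A \<delta>) (\<lambda>h. \<integral>x. loss_hess (sqrt \<delta>) (P x) x \<theta> h \<partial>N) \<theta>"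
    and "integrable N (\<lambda>x. loss_hess (sqrt \<delta>) (P x) x \<theta> h)"
proof -
  let ?s = "sqrt \<delta>"
  define m where "m = snd \<theta> / 2"
  define R where "R = 2 * norm (fst \<theta>)"
  \<comment> \<open>A \<open>\<kappa>\<close> strictly between the quotient at
    \<open>\<theta>\<close> and 1 leaves room for a neighbourhood on which \<open>ratio\<close>
    times \<open>M\<close> stays uniformly below 1.\<close>
  obtain \<kappa> where \<kappa>: "0 < \<kappa>" "\<kappa> < 1" "?s * (norm (fst \<theta>))\<^sup>2 * M < \<kappa> * (2 * snd \<theta> * \<rho>min)"
  proof -
    let ?r = "?s * (norm (fst \<theta>))\<^sup>2 * M / (2 * snd \<theta> * \<rho>min)"
    have r: "0 \<le> ?r" "?r < 1" using small pos rho M_pos by (auto simp: divide_simps)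
    from dense[OF r(2)] obtain k where k: "?r < k" "k < 1" by blast
    moreover have "0 < k" using r(1) k(1) by linarith
    ultimately show thesis using that[of k] pos rho by (simp add: pos_divide_less_eq)
  qed
  \<comment> \<open>The condition \<open>0 < norm (fst y)\<close> makes the form at
    \<open>fst y\<close> positive, as \<open>robust_loss_eq\<close> requires; the last condition
    bounds \<open>ratio\<close> times \<open>M\<close> by \<open>\<kappa>\<close>. \<open>S\<close>
    is open but, omitting \<open>fst y = 0\<close>, not convex, so the argument moves to a ball
    inside it.\<close>
  define S where "S = {y :: (real ^ 'n) \<times> real. 0 < norm (fst y) \<and> m < snd y \<and> snd y < 4 * m \<and> norm (fst y) < R
     \<and> ?s * (norm (fst y))\<^sup>2 * M < \<kappa> * (2 * snd y * \<rho>min)}"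
  have "open S"
    unfolding S_def by (intro open_Collect_conj open_Collect_less continuous_intros)
  moreover have "\<theta> \<in> S" using pos \<kappa> by (auto simp: S_def m_def R_def)
  ultimately obtain r where r: "0 < r" "ball \<theta> r \<subseteq> S" by (meson open_contains_ball)
  have inv: "AE x in N. (\<forall>v. norm (P x *v v) \<le> 1 / \<rho>min * norm v) \<and> (\<forall>w. (norm w)\<^sup>2 / \<rho>max \<le> w \<bullet> (P x *v w))"
    using bounds by eventually_elim (use spd_inv_bounds[OF spd rho] in \<open>auto simp: P_def\<close>)
  have ratio: "0 < ratio ?s (P x) y \<and> \<bar>ratio ?s (P x) y\<bar> * M \<le> \<kappa> \<and> 0 < fst y \<bullet> (P x *v fst y)"
    if y: "y \<in> S" and x: "\<forall>v. norm (P x *v v) \<le> 1 / \<rho>min * norm v" "\<forall>w. (norm w)\<^sup>2 / \<rho>max \<le> w \<bullet> (P x *v w)" for x y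
  proof -
    have sy: "0 < snd y" using y pos by (auto simp: S_def m_def)
    have "0 < (norm (fst y))\<^sup>2 / \<rho>max" using y rho by (auto simp: S_def)
    then have b: "0 < fst y \<bullet> (P x *v fst y)" using x(2) by (meson less_le_trans)
    have "fst y \<bullet> (P x *v fst y) \<le> norm (fst y) * (1 / \<rho>min * norm (fst y))"
      using x(1) by (intro order_trans[OF norm_cauchy_schwarz] mult_left_mono) auto
    then have "?s * (fst y \<bullet> (P x *v fst y)) * M \<le> ?s * (norm (fst y))\<^sup>2 * M / \<rho>min"
      using pos M_pos rho mult_left_mono[of _ _ "?s * M"] by (simp add: power2_eq_square field_simps)
    also have "\<dots> \<le> \<kappa> * (2 * snd y)"
      using y rho by (auto simp: S_def field_simps)
    finally have "ratio ?s (P x) y * M \<le> \<kappa>" using sy by (simp add: ratio_def field_simps)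
    moreover have "0 < ratio ?s (P x) y" using b sy pos by (simp add: ratio_def)
    ultimately show ?thesis using b by simp
  qed
  obtain C where C: "\<And>(P :: real ^ 'n ^ 'n) x y. \<lbrakk>\<And>v. norm (P *v v) \<le> 1 / \<rho>min * norm v; m \<le> snd y; snd y \<le> 4 * m;
       norm (fst y) \<le> R; \<bar>ratio ?s P y\<bar> * M \<le> \<kappa>\<rbrakk> \<Longrightarrow>
       \<bar>loss_value ?s P x y\<bar> \<le> C * (1 + norm x)\<^sup>2 \<and> norm (loss_grad ?s P x y) \<le> C * (1 + norm x)\<^sup>2 \<and>
       (\<forall>h. norm (loss_hess ?s P x y h) \<le> C * (1 + norm x)\<^sup>2 * norm h)"
    by (rule growth_bounds[of ?s "1 / \<rho>min" m R \<kappa> "4 * m"]) (use pos rho \<kappa> in \<open>auto simp: m_def R_def\<close>)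
  have bd: "\<bar>loss_value ?s (P x) x y\<bar> \<le> C * (1 + norm x)\<^sup>2 \<and> norm (loss_grad ?s (P x) x y) \<le> C * (1 + norm x)\<^sup>2 \<and>
       (\<forall>h. norm (loss_hess ?s (P x) x y h) \<le> C * (1 + norm x)\<^sup>2 * norm h)"
    if y: "y \<in> ball \<theta> r" and x: "\<forall>v. norm (P x *v v) \<le> 1 / \<rho>min * norm v" "\<forall>w. (norm w)\<^sup>2 / \<rho>max \<le> w \<bullet> (P x *v w)" for x y
  proof (rule C)
    have "y \<in> S" using y r by blast
    then show "m \<le> snd y" "snd y \<le> 4 * m" "norm (fst y) \<le> R" "\<bar>ratio ?s (P x) y\<bar> * M \<le> \<kappa>"
      using ratio[OF _ x] by (auto simp: S_def)
  qed (use x in auto)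
  have dv: "(loss_value ?s (P x) x has_derivative (\<lambda>h. loss_grad ?s (P x) x y \<bullet> h)) (at y)"
    and dg: "(loss_grad ?s (P x) x has_derivative loss_hess ?s (P x) x y) (at y)"
    if y: "y \<in> ball \<theta> r" and x: "\<forall>v. norm (P x *v v) \<le> 1 / \<rho>min * norm v" "\<forall>w. (norm w)\<^sup>2 / \<rho>max \<le> w \<bullet> (P x *v w)" for x y
  proof -
    have yS: "y \<in> S" using y r by blast
    have 1: "\<And>v w. (P x *v v) \<bullet> w = v \<bullet> (P x *v w)" unfolding P_def by (rule spd_inv_self_adjoint[OF spd])
    have 2: "snd y \<noteq> 0" using yS pos by (auto simp: S_def m_def)
    have 3: "\<bar>ratio ?s (P x) y\<bar> * M < 1" using ratio[OF yS x] \<kappa> by auto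
    show "(loss_value ?s (P x) x has_derivative (\<lambda>h. loss_grad ?s (P x) x y \<bullet> h)) (at y)"
      "(loss_grad ?s (P x) x has_derivative loss_hess ?s (P x) x y) (at y)"
      using has_derivative_loss_value[OF 1 2 3] has_derivative_loss_grad[OF 1 2 3] by blast+
  qed
  have meas: "(\<lambda>x. loss_value ?s (P x) x y) \<in> borel_measurable N"
    "(\<lambda>x. loss_grad ?s (P x) x y) \<in> borel_measurable N"
    "(\<lambda>x. loss_hess ?s (P x) x y h) \<in> borel_measurable N" for y h
    unfolding measurable_cong_sets[OF borel refl] P_def
    by (intro loss_measurable matrix_inv_measurable spd lsc)+
  have dom: "integrable N (\<lambda>x. C * (1 + norm x)\<^sup>2)" using moment by simp
  have intv: "integrable N (\<lambda>x. loss_value ?s (P x) x y)" and intg: "integrable N (\<lambda>x. loss_grad ?s (P x) x y)"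
    if y: "y \<in> ball \<theta> r" for y
    by (rule Bochner_Integration.integrable_bound[OF dom meas(1)], use inv in eventually_elim,
        use bd[OF y] in \<open>force intro: order_trans[OF _ abs_ge_self]\<close>)
      (rule Bochner_Integration.integrable_bound[OF dom meas(2)], use inv in eventually_elim,
        use bd[OF y] in \<open>force intro: order_trans[OF _ abs_ge_self]\<close>)
  define f where "f y = (\<integral>x. loss_value ?s (P x) x y \<partial>N)" for y
  define g where "g y = (\<integral>x. loss_grad ?s (P x) x y \<partial>N)" for y
  have f: "(f has_derivative (\<lambda>h. g y \<bullet> h)) (at y)" if y: "y \<in> ball \<theta> r" for y
  proof -
    have "(f has_derivative (\<lambda>v. \<integral>x. loss_grad ?s (P x) x y \<bullet> v \<partial>N)) (at y)"
      unfolding f_def[abs_def]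
    proof (rule has_derivative_integral(3)[where f = "\<lambda>y x. loss_value ?s (P x) x y" and f' = "\<lambda>y x v. loss_grad ?s (P x) x y \<bullet> v",
          OF open_ball convex_ball y meas(1) _ intv[OF y] dom])
      show "(\<lambda>x. loss_grad ?s (P x) x y \<bullet> h) \<in> borel_measurable N" for h
        using meas(2)[of y] by measurable
      show "AE x in N. \<forall>y\<in>ball \<theta> r. (loss_value ?s (P x) x has_derivative (\<bullet>) (loss_grad ?s (P x) x y)) (at y)"
        using inv by eventually_elim (use dv in blast)
      show "AE x in N. \<forall>y\<in>ball \<theta> r. \<forall>v. norm (loss_grad ?s (P x) x y \<bullet> v) \<le> C * (1 + norm x)\<^sup>2 * norm v"
        using inv
      proof eventually_elim
        case (elim x)
        then show ?case
          using bd by (auto intro!: order_trans[OF Cauchy_Schwarz_ineq2] mult_right_mono)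
      qed
    qed
    moreover have "(\<integral>x. loss_grad ?s (P x) x y \<bullet> v \<partial>N) = g y \<bullet> v" for v
      unfolding g_def using intg[OF y] by simp
    ultimately show ?thesis by simp
  qed
  have hess: "(g has_derivative (\<lambda>h. \<integral>x. loss_hess ?s (P x) x \<theta> h \<partial>N)) (at \<theta>)
      \<and> integrable N (\<lambda>x. loss_hess ?s (P x) x \<theta> h)" for h
  proof -
    have \<theta>: "\<theta> \<in> ball \<theta> r" using r by simp
    have 1: "AE x in N. \<forall>y\<in>ball \<theta> r. (loss_grad ?s (P x) x has_derivative loss_hess ?s (P x) x y) (at y)"
      using inv by eventually_elim (use dg in blast)
    have 2: "AE x in N. \<forall>y\<in>ball \<theta> r. \<forall>v. norm (loss_hess ?s (P x) x y v) \<le> C * (1 + norm x)\<^sup>2 * norm v"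
      using inv by eventually_elim (use bd in blast)
    show ?thesis
      unfolding g_def[abs_def]
      using has_derivative_integral(2,3)[where f = "\<lambda>y x. loss_grad ?s (P x) x y" and f' = "\<lambda>y x. loss_hess ?s (P x) x y",
          OF open_ball convex_ball \<theta> meas(2) meas(3) intg[OF \<theta>] dom 1 2]
      by blast
  qed
  then show "integrable N (\<lambda>x. loss_hess ?s (P x) x \<theta> h)" by blast
  have eq: "robust_objective N l A \<delta> y = ereal (f y)" if y: "y \<in> ball \<theta> r" for y
  proof -
    have "AE x in N. robust_loss l A \<delta> (fst y) (snd y) x = ereal (loss_value ?s (P x) x y)"
      using inv
    proof eventually_elim
      case (elim x)
      have yS: "y \<in> S" using y r by blast
      then have "0 < snd y" using pos by (auto simp: S_def m_def)
      moreover have "ratio ?s (P x) y * M < 1" "0 < fst y \<bullet> (P x *v fst y)"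
        using ratio[OF yS, of x] elim \<kappa> by auto
      ultimately show ?case
        using robust_loss_eq[of \<delta> "snd y" "fst y" A x] pos by (simp add: P_def)
    qed
    then show ?thesis
      using ereal_expectation_cong_AE ereal_expectation_ereal[OF intv[OF y]]
      by (fastforce simp: robust_objective_def f_def split_beta)
  qed
  show "has_hessian (robust_objective N l A \<delta>) (\<lambda>h. \<integral>x. loss_hess ?s (P x) x \<theta> h \<partial>N) \<theta>"
    unfolding has_hessian_def
  proof (intro exI[of _ g] conjI)
    have "\<forall>\<^sub>F y in nhds \<theta>. y \<in> ball \<theta> r"
      using r by (intro eventually_nhds_in_open) auto
    then show "\<forall>\<^sub>F y in nhds \<theta>. \<bar>robust_objective N l A \<delta> y\<bar> \<noteq> \<infinity> \<and>
        (GDERIV (\<lambda>z. real_of_ereal (robust_objective N l A \<delta> z)) y :> g y)"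
    proof eventually_elim
      case (elim y)
      have "((\<lambda>z. real_of_ereal (robust_objective N l A \<delta> z)) has_derivative (\<lambda>h. g y \<bullet> h)) (at y)"
        by (rule has_derivative_transform_within_open[OF f[OF elim] open_ball elim]) (simp add: eq)
      then show ?case by (simp add: gderiv_def eq[OF elim] inner_commute)
    qed
  qed (use hess in blast)
qed

end

section \<open>Lower bounds for the Hessian form at a single data point\<close>

context smooth_loss
begin

text \<open>With \<open>\<sigma> = snd h / snd y\<close> and transverse part \<open>w\<close>, the
  rank-one term controls \<open>\<sigma>\<close> up to an error of order \<open>norm w\<close>, and
  the quadratic-over-linear term controls \<open>w\<close> with a factor of order \<open>s\<close>.
  Using only a fraction of order \<open>s\<close> of the rank-one term keeps the error below that
  gain.\<close>

lemma loss_hess_lower_bound: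
  fixes m \<Lambda> R K G a b k \<rho>min \<rho>max :: real
  assumes pos: "0 < m" "0 < \<Lambda>" "0 \<le> R" "0 \<le> K" "0 \<le> G" "0 < a" "0 < b" "0 < k" "0 < \<rho>min" "0 < \<rho>max"
  obtains \<kappa> where "0 < \<kappa>"
    "\<And>s (P :: real ^ 'n ^ 'n) x y h. \<lbrakk>\<And>v w. (P *v v) \<bullet> w = v \<bullet> (P *v w);
       \<And>v. norm (P *v v) \<le> 1 / \<rho>min * norm v; \<And>w. (norm w)\<^sup>2 / \<rho>max \<le> w \<bullet> (P *v w);
       0 < s; s \<le> 1; m \<le> snd y; snd y \<le> \<Lambda>; norm (fst y) \<le> R; \<bar>ratio s P y\<bar> * M < 1; norm x \<le> K;
       \<bar>l1 (state s P x y)\<bar> \<le> G; a \<le> \<bar>l1 (state s P x y)\<bar>; b \<le> \<bar>state s P x y\<bar>; k \<le> l2 (state s P x y)\<rbrakk>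
     \<Longrightarrow> s * \<kappa> * (norm h)\<^sup>2 \<le> loss_hess s P x y h \<bullet> h"
proof -
  \<comment> \<open>The quadratic-over-linear term is at least \<open>s * c\<close> times the square
    of \<open>norm w\<close>, and \<open>L\<close> bounds \<open>\<bar>z\<bar> / norm w\<close>. The
    fraction \<open>\<epsilon>\<close> is small enough that the error consumes at most half of
    \<open>c\<close>, and \<open>d\<close> serves to recover \<open>norm h\<close> from
    \<open>w\<close> and \<open>\<sigma>\<close>.\<close>
  define c where "c = a\<^sup>2 / 2 / (\<Lambda> * \<rho>max)"
  define L where "L = K + G / m * (1 / \<rho>min * R) + 1"
  define \<epsilon> where "\<epsilon> = min 1 (c / (2 * k * L\<^sup>2))"
  define d where "d = 2 * R\<^sup>2 + \<Lambda>\<^sup>2"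
  define \<kappa> where "\<kappa> = min (c / 4) (k * \<epsilon> * b\<^sup>2 / (2 * d))"
  have c: "0 < c" using pos by (simp add: c_def)
  have L: "0 < L" using pos by (auto simp: L_def intro!: add_nonneg_pos)
  have \<epsilon>: "0 < \<epsilon>" "\<epsilon> \<le> 1" "k * \<epsilon> * L\<^sup>2 \<le> c / 2"
  proof -
    show "0 < \<epsilon>" "\<epsilon> \<le> 1" using c L pos by (auto simp: \<epsilon>_def)
    have "\<epsilon> \<le> c / (2 * k * L\<^sup>2)" by (simp add: \<epsilon>_def)
    then show "k * \<epsilon> * L\<^sup>2 \<le> c / 2" using L pos by (simp add: field_simps)
  qed
  have d: "0 < d" using pos by (auto simp: d_def intro!: add_nonneg_pos)
  show thesis
  proof (rule that)
    show "0 < \<kappa>" using c \<epsilon> d pos by (simp add: \<kappa>_def)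
    fix s :: real and P :: "real ^ 'n ^ 'n" and x y h
    assume sym: "\<And>v w. (P *v v) \<bullet> w = v \<bullet> (P *v w)"
      and P: "\<And>v. norm (P *v v) \<le> 1 / \<rho>min * norm v" and low: "\<And>w. (norm w)\<^sup>2 / \<rho>max \<le> w \<bullet> (P *v w)"
      and s: "0 < s" "s \<le> 1" and y: "m \<le> snd y" "snd y \<le> \<Lambda>" "norm (fst y) \<le> R"
      and small: "\<bar>ratio s P y\<bar> * M < 1" and x: "norm x \<le> K"
      and g: "\<bar>l1 (state s P x y)\<bar> \<le> G" "a \<le> \<bar>l1 (state s P x y)\<bar>"
      and u: "b \<le> \<bar>state s P x y\<bar>" and l2: "k \<le> l2 (state s P x y)"
    have sy: "0 < snd y" using y pos by simp
    have nn: "0 \<le> w \<bullet> (P *v w)" for w using low[of w] pos order_trans[of 0 "(norm w)\<^sup>2 / \<rho>max"] by simp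
    define w where "w = transverse y h"
    define \<sigma> where "\<sigma> = snd h / snd y"
    define z where "z = w \<bullet> (x + (l1 (state s P x y) * s / snd y) *\<^sub>R (P *v fst y))"
    have "\<bar>z\<bar> \<le> norm w * L"
    proof -
      have "norm ((l1 (state s P x y) * s / snd y) *\<^sub>R (P *v fst y)) \<le> G / m * (1 / \<rho>min * R)"
      proof -
        have "\<bar>l1 (state s P x y)\<bar> * s / snd y \<le> G * 1 / m"
          using g s y pos by (intro frac_le mult_mono) auto
        moreover have "norm (P *v fst y) \<le> 1 / \<rho>min * R"
          using P[of "fst y"] mult_left_mono[OF y(3), of "1 / \<rho>min"] pos by simp
        ultimately have "\<bar>l1 (state s P x y)\<bar> * s / snd y * norm (P *v fst y) \<le> G * 1 / m * (1 / \<rho>min * R)"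
          by (rule mult_mono) (use pos in auto)
        then show ?thesis using s sy by (simp add: abs_mult)
      qed
      then have "norm (x + (l1 (state s P x y) * s / snd y) *\<^sub>R (P *v fst y)) \<le> L"
        using norm_triangle_ineq[of x "(l1 (state s P x y) * s / snd y) *\<^sub>R (P *v fst y)"] x
        unfolding L_def by linarith
      then show ?thesis unfolding z_def
        by (intro order_trans[OF Cauchy_Schwarz_ineq2 mult_left_mono]) auto
    qed
    then have z2: "z\<^sup>2 \<le> (norm w)\<^sup>2 * L\<^sup>2"
      using power_mono[of "\<bar>z\<bar>" "norm w * L" 2] by (simp add: power_mult_distrib)
    have u2: "b\<^sup>2 \<le> (state s P x y)\<^sup>2" using power_mono[OF u, of 2] pos by simp
    \<comment> \<open>As \<open>ratio\<close> is nonnegative here, the Jacobian lies in (0, 1], and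
      dividing by it can only increase \<open>l2\<close>.\<close>
    have curv: "k \<le> curvature s P x y"
    proof -
      have q: "0 \<le> ratio s P y" using nn s sy by (simp add: ratio_def)
      have "1 - ratio s P y * l2 (state s P x y) \<le> 1" using q l2_nonneg by simp
      moreover have "0 < 1 - ratio s P y * l2 (state s P x y)"
        using jacobian_ge[of "ratio s P y" "state s P x y"] small by linarith
      ultimately have "l2 (state s P x y) / 1 \<le> curvature s P x y"
        unfolding curvature_def by (intro divide_left_mono) (auto simp: l2_nonneg)
      then show ?thesis using l2 by simp
    qed
    have "s * ((c / 2) * (norm w)\<^sup>2 + (k * \<epsilon> * b\<^sup>2 / 2) * \<sigma>\<^sup>2)
       \<le> k * \<epsilon> * s * (\<sigma>\<^sup>2 * b\<^sup>2 / 2 - (norm w)\<^sup>2 * L\<^sup>2) + s * c * (norm w)\<^sup>2"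
    proof -
      have "s * (norm w)\<^sup>2 * (k * \<epsilon> * L\<^sup>2) \<le> s * (norm w)\<^sup>2 * (c / 2)"
        using \<epsilon>(3) s by (intro mult_left_mono) auto
      then show ?thesis by (simp add: algebra_simps)
    qed
    also have "k * \<epsilon> * s * (\<sigma>\<^sup>2 * b\<^sup>2 / 2 - (norm w)\<^sup>2 * L\<^sup>2) \<le> curvature s P x y * (\<sigma> * state s P x y + z)\<^sup>2"
    proof -
      have "\<sigma>\<^sup>2 * b\<^sup>2 \<le> (\<sigma> * state s P x y)\<^sup>2" using u2 by (simp add: power_mult_distrib mult_left_mono)
      \<comment> \<open>The difference of the two sides is half the square of
        \<open>\<sigma> * state s P x y + 2 * z\<close>.\<close>
      moreover have "(\<sigma> * state s P x y)\<^sup>2 / 2 - z\<^sup>2 \<le> (\<sigma> * state s P x y + z)\<^sup>2"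
        using zero_le_power2[of "\<sigma> * state s P x y + 2 * z"] by (simp add: power2_eq_square algebra_simps)
      ultimately have "\<sigma>\<^sup>2 * b\<^sup>2 / 2 - (norm w)\<^sup>2 * L\<^sup>2 \<le> (\<sigma> * state s P x y + z)\<^sup>2"
        using z2 by linarith
      then have "k * \<epsilon> * s * (\<sigma>\<^sup>2 * b\<^sup>2 / 2 - (norm w)\<^sup>2 * L\<^sup>2) \<le> k * \<epsilon> * s * (\<sigma> * state s P x y + z)\<^sup>2"
        using pos \<epsilon> s by (intro mult_left_mono) auto
      also have "\<dots> \<le> curvature s P x y * (\<sigma> * state s P x y + z)\<^sup>2"
      proof (rule mult_right_mono)
        have "\<epsilon> * s \<le> 1" using \<epsilon> s by (intro mult_le_one) auto
        then have "k * (\<epsilon> * s) \<le> k" using pos by (intro mult_left_le) auto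
        then show "k * \<epsilon> * s \<le> curvature s P x y" using curv by (simp add: mult.assoc)
      qed simp
      finally show ?thesis .
    qed
    also have "s * c * (norm w)\<^sup>2 \<le> (l1 (state s P x y))\<^sup>2 / 2 * (s / snd y * (w \<bullet> (P *v w)))"
    proof -
      have "a\<^sup>2 / 2 * (s / \<Lambda> * ((norm w)\<^sup>2 / \<rho>max)) \<le> (l1 (state s P x y))\<^sup>2 / 2 * (s / snd y * (w \<bullet> (P *v w)))"
      proof (intro mult_mono)
        show "a\<^sup>2 / 2 \<le> (l1 (state s P x y))\<^sup>2 / 2" using power_mono[OF g(2), of 2] pos by simp
        show "s / \<Lambda> \<le> s / snd y" using y s sy by (intro frac_le) auto
      qed (use low nn s sy pos in auto)
      then show ?thesis by (simp add: c_def mult_ac)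
    qed
    also have "curvature s P x y * (\<sigma> * state s P x y + z)\<^sup>2 + (l1 (state s P x y))\<^sup>2 / 2 * (s / snd y * (w \<bullet> (P *v w)))
        = loss_hess s P x y h \<bullet> h"
      using inner_loss_hess[OF sym _ small, of x h h] state_dir_inner[OF sym _ small, of x h] sy
      by (simp add: \<sigma>_def z_def w_def power2_eq_square mult.assoc)
    finally have main: "s * ((c / 2) * (norm w)\<^sup>2 + (k * \<epsilon> * b\<^sup>2 / 2) * \<sigma>\<^sup>2) \<le> loss_hess s P x y h \<bullet> h"
      by simp
    have "(norm h)\<^sup>2 \<le> 2 * (norm w)\<^sup>2 + d * \<sigma>\<^sup>2"
    proof -
      have "fst h = \<sigma> *\<^sub>R fst y + w" by (simp add: w_def \<sigma>_def transverse_def)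
      then have "norm (fst h) \<le> \<bar>\<sigma>\<bar> * norm (fst y) + norm w"
        using norm_triangle_ineq[of "\<sigma> *\<^sub>R fst y" w] by simp
      also have "\<dots> \<le> \<bar>\<sigma>\<bar> * R + norm w" using y by (simp add: mult_left_mono)
      finally have "(norm (fst h))\<^sup>2 \<le> (\<bar>\<sigma>\<bar> * R + norm w)\<^sup>2" by (intro power_mono) auto
      also have "\<dots> \<le> 2 * (\<bar>\<sigma>\<bar> * R)\<^sup>2 + 2 * (norm w)\<^sup>2"
        using zero_le_power2[of "\<bar>\<sigma>\<bar> * R - norm w"] by (simp add: power2_eq_square algebra_simps)
      finally have "(norm (fst h))\<^sup>2 \<le> 2 * R\<^sup>2 * \<sigma>\<^sup>2 + 2 * (norm w)\<^sup>2" by (simp add: power_mult_distrib mult_ac)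
      moreover have "(snd h)\<^sup>2 \<le> \<Lambda>\<^sup>2 * \<sigma>\<^sup>2"
      proof -
        have "snd h = snd y * \<sigma>" using sy by (simp add: \<sigma>_def)
        then show ?thesis using power_mono[OF y(2), of 2] sy by (simp add: power_mult_distrib mult_right_mono)
      qed
      moreover have "(norm h)\<^sup>2 = (norm (fst h))\<^sup>2 + (snd h)\<^sup>2" by (simp add: norm_prod_def)
      ultimately show ?thesis by (simp add: d_def algebra_simps)
    qed
    then have "\<kappa> * (norm h)\<^sup>2 \<le> \<kappa> * (2 * (norm w)\<^sup>2 + d * \<sigma>\<^sup>2)"
      using \<open>0 < \<kappa>\<close> by (intro mult_left_mono) auto
    also have "\<dots> = 2 * \<kappa> * (norm w)\<^sup>2 + \<kappa> * d * \<sigma>\<^sup>2" by (simp add: algebra_simps)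
    also have "\<dots> \<le> (c / 2) * (norm w)\<^sup>2 + (k * \<epsilon> * b\<^sup>2 / 2) * \<sigma>\<^sup>2"
    proof (intro add_mono mult_right_mono)
      show "2 * \<kappa> \<le> c / 2" by (simp add: \<kappa>_def)
      have "\<kappa> \<le> k * \<epsilon> * b\<^sup>2 / (2 * d)" by (simp add: \<kappa>_def)
      then show "\<kappa> * d \<le> k * \<epsilon> * b\<^sup>2 / 2" using d by (simp add: field_simps)
    qed auto
    finally have "s * (\<kappa> * (norm h)\<^sup>2) \<le> s * ((c / 2) * (norm w)\<^sup>2 + (k * \<epsilon> * b\<^sup>2 / 2) * \<sigma>\<^sup>2)"
      using s by (intro mult_left_mono) auto
    then show "s * \<kappa> * (norm h)\<^sup>2 \<le> loss_hess s P x y h \<bullet> h" using main by (simp add: mult.assoc)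
  qed
qed

text \<open>Outside the event supplied by the spread condition there is no quantitative bound; this
  lets those data points be discarded from the expectation.\<close>

lemma loss_hess_nonneg:
  assumes sym: "\<And>v w. (P *v v) \<bullet> w = v \<bullet> (P *v w)" and nn: "\<And>w. 0 \<le> w \<bullet> (P *v w)"
    and "0 < s" "0 < snd y" and small: "\<bar>ratio s P y\<bar> * M < 1"
  shows "0 \<le> loss_hess s P x y h \<bullet> h"
proof -
  have "0 \<le> curvature s P x y * ((state_dir s P x y \<bullet> h) * (state_dir s P x y \<bullet> h))"
    using curvature_bounds(1)[OF order_refl small] by (intro mult_nonneg_nonneg[OF _ zero_le_square])
  moreover have "0 \<le> (l1 (state s P x y))\<^sup>2 / 2 * (s / snd y * (transverse y h \<bullet> (P *v transverse y h)))"
    using assms by simp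
  ultimately show ?thesis
    using inner_loss_hess[OF sym _ small, of x h h] assms by (simp add: mult.assoc)
qed

end

text \<open>Adding the tangent inequalities of the convex function at two points shows that its
  derivative \<open>f1\<close> is monotone. A monotone function has a nonnegative derivative
  wherever it is differentiable.\<close>

lemma deriv2_ge_strong_convexity:
  fixes l :: "real \<Rightarrow> real"
  assumes conv: "convex_on {a..b} (\<lambda>u. l u - m * u\<^sup>2 / 2)"
    and l1: "\<And>u. (l has_real_derivative l1 u) (at u)"
    and l2: "(l1 has_real_derivative D) (at u)" and u: "a < u" "u < b"
  shows "m \<le> D"
proof -
  define f where "f u = l u - m * u\<^sup>2 / 2" for u
  define f1 where "f1 u = l1 u - m * u" for u
  have f: "(f has_real_derivative f1 u) (at u)" for u
    unfolding f_def[abs_def] f1_def by (rule derivative_eq_intros l1 refl | simp)+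
  have "mono_on {a<..<b} f1"
  proof (rule mono_onI)
    fix v w assume vw: "v \<in> {a<..<b}" "w \<in> {a<..<b}" "v \<le> w"
    have t: "f z' - f z \<ge> f1 z * (z' - z)" if "z \<in> {a<..<b}" "z' \<in> {a<..<b}" for z z'
      using that conv by (intro convex_on_imp_above_tangent[of "{a..b}"])
        (auto simp: f_def[abs_def] interior_atLeastAtMost_real intro!: has_field_derivative_at_within[OF f[unfolded f_def[abs_def]]])
    have "0 \<le> (f1 w - f1 v) * (w - v)"
      using t[of v w] t[of w v] vw by (simp add: algebra_simps)
    then show "f1 v \<le> f1 w" using vw by (cases "v = w") (auto simp: zero_le_mult_iff)
  qed
  moreover have "(f1 has_real_derivative D - m) (at u)"
    unfolding f1_def[abs_def] by (rule derivative_eq_intros l2 refl | simp)+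
  ultimately have "0 \<le> D - m" by (rule mono_on_imp_deriv_nonneg) (use u in auto)
  then show ?thesis by simp
qed

section \<open>Choice of the constants and integration of the pointwise bounds\<close>

theorem theorem4:
  fixes B :: "(real ^ 'n) set"
    and P0 :: "(real ^ 'n) measure"
    and l :: "real \<Rightarrow> real"
    and A :: "real ^ 'n \<Rightarrow> real ^ 'n ^ 'n"
    and \<rho>min \<rho>max M Llow Lup :: real
  assumes B_nonempty: "B \<noteq> {}"
    and P0_prob: "prob_space P0" and P0_borel: "sets P0 = sets borel"
    and A_spd: "\<And>x. A x \<in> spd_matrices"
    and cost_lsc: "lower_semicontinuous (\<lambda>(x, x'). transport_cost A x x')"
    and rho_pos: "0 < \<rho>min" "0 < \<rho>max"
    and A_bounds: "AE x in P0. \<forall>v. norm v = 1 \<longrightarrow>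
                     \<rho>min \<le> v \<bullet> (A x *v v) \<and> v \<bullet> (A x *v v) \<le> \<rho>max"
    and l_convex: "convex_on UNIV l"
    and growth_finite: "\<bar>growth_rate l\<bar> \<noteq> \<infinity>"
    and fourth_moment: "integrable P0 (\<lambda>x. norm x ^ 4)"
    and l_diff: "\<And>u. l differentiable (at u)"
    and l_diff2: "\<And>u. deriv l differentiable (at u)"
    and M_pos: "0 < M" and l_second: "\<And>u. deriv (deriv l) u \<le> M"
    and l_nondegenerate: "\<And>\<beta>. \<beta> \<in> B \<Longrightarrow> 0 < measure P0 {x. deriv l (\<beta> \<bullet> x) \<noteq> 0}"
    and B_convex: "convex B" and B_compact: "compact B"
    and l_locally_sc: "locally_strongly_convex l"
    and l_spread: "\<exists>c1 c2 p. 0 < c1 \<and> 0 < c2 \<and> 0 < p \<and> p < 1 \<and>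
                     (\<forall>\<beta>\<in>B. p \<le> measure P0 {x. \<bar>deriv l (\<beta> \<bullet> x)\<bar> > c1 \<and> \<bar>\<beta> \<bullet> x\<bar> > c2 * norm \<beta>})"
    and L_pos: "0 < Llow" "0 < Lup"
    and L_bounds: "\<And>\<beta>. \<beta> \<in> B \<Longrightarrow> Llow \<le> (LINT x|P0. (deriv l (\<beta> \<bullet> x))\<^sup>2) \<and>
                                  (LINT x|P0. (deriv l (\<beta> \<bullet> x))\<^sup>2) \<le> Lup"
  shows "\<exists>\<delta>1 \<kappa>1. 0 < \<delta>1 \<and> \<delta>1 < delta0 Llow \<rho>min \<rho>max M (radius B) \<and> 0 < \<kappa>1 \<and>
           (\<forall>\<delta>. 0 < \<delta> \<and> \<delta> < \<delta>1 \<longrightarrow>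
              (\<forall>\<theta> \<in> strong_convexity_region B Llow Lup \<rho>min \<rho>max M \<delta>.
                 \<exists>H. has_hessian (robust_objective P0 l A \<delta>) H \<theta> \<and>
                     loewner_ge H (\<lambda>v. (sqrt \<delta> * \<kappa>1) *\<^sub>R v)))"
proof -
  interpret prob_space P0 by (rule P0_prob)
  have space: "space P0 = UNIV" using sets_eq_imp_space_eq[OF P0_borel] by simp
  have l1: "(l has_real_derivative deriv l u) (at u)" for u
    using l_diff by (simp add: DERIV_deriv_iff_real_differentiable)
  have l2: "(deriv l has_real_derivative deriv (deriv l) u) (at u)" for u
    using l_diff2 by (simp add: DERIV_deriv_iff_real_differentiable)
  have sc: "\<exists>k>0. \<forall>u. a < u \<and> u < b \<longrightarrow> k \<le> deriv (deriv l) u" if "a \<le> b" for a b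
    using l_locally_sc that deriv2_ge_strong_convexity[OF _ l1 l2]
    unfolding locally_strongly_convex_def by meson
  have l2_nonneg: "0 \<le> deriv (deriv l) u" for u
    using sc[of "u - 1" "u + 1"] by (force intro: order_trans[OF less_imp_le])
  interpret smooth_loss l "deriv l" "deriv (deriv l)" M
    by unfold_locales (use M_pos l1 l2 l2_nonneg l_second in auto)
  obtain c1 c2 p where c: "0 < c1" "0 < c2" "0 < p" "p < 1"
    and spread: "\<And>\<beta>. \<beta> \<in> B \<Longrightarrow> p \<le> prob {x. \<bar>deriv l (\<beta> \<bullet> x)\<bar> > c1 \<and> \<bar>\<beta> \<bullet> x\<bar> > c2 * norm \<beta>}"
    using l_spread by blast
  text \<open>The spread condition fails at \<open>\<beta> = 0\<close>, so \<open>B\<close> keeps a positive distance from the origin.\<close>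
  have "0 \<notin> B"
  proof
    assume "0 \<in> B"
    from spread[OF this] c show False by simp
  qed
  obtain r where r: "0 < r" "\<And>\<beta>. \<beta> \<in> B \<Longrightarrow> r \<le> norm \<beta>"
  proof -
    have "\<exists>\<beta>\<in>B. \<forall>\<beta>'\<in>B. norm \<beta> \<le> norm \<beta>'"
      by (intro continuous_attains_inf B_compact B_nonempty continuous_intros)
    then show thesis using that \<open>0 \<notin> B\<close> by (metis zero_less_norm_iff)
  qed
  define R where "R = radius B"
  have RB: "norm \<beta> \<le> R" if "\<beta> \<in> B" for \<beta>
  proof -
    have "bdd_above (norm ` B)"
      by (intro bounded_imp_bdd_above compact_imp_bounded compact_continuous_image continuous_intros B_compact)
    then show ?thesis unfolding R_def radius_def using that by (rule cSUP_upper2) simp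
  qed
  have R: "0 < R" using B_nonempty r RB by force
  have moment: "integrable P0 (\<lambda>x. (1 + norm x)\<^sup>2)"
  proof (rule Bochner_Integration.integrable_bound[where f = "\<lambda>x. 4 + 4 * norm x ^ 4"])
    have "(1 + t)\<^sup>2 \<le> 4 + 4 * t ^ 4" for t :: real
    proof -
      \<comment> \<open>The right-hand side is the difference of the two bounds, written as a sum of
        squares plus a constant.\<close>
      have "0 \<le> (1 - t)\<^sup>2 + (2 * t\<^sup>2 - 1 / 2)\<^sup>2 + 7 / 4" by simp
      then show ?thesis by (simp add: power2_eq_square power4_eq_xxxx algebra_simps)
    qed
    then show "AE x in P0. norm ((1 + norm x)\<^sup>2) \<le> norm (4 + 4 * norm x ^ 4)" by simp
  qed (use fourth_moment P0_borel in \<open>auto simp: measurable_cong_sets[OF P0_borel refl]\<close>)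
  obtain K where K: "0 \<le> K" "prob {x. K < norm x} \<le> p / 2"
  proof -
    define I where "I = (\<integral>x. (1 + norm x)\<^sup>2 \<partial>P0)"
    \<comment> \<open>Markov's inequality gives \<open>I / K\<close>, which is at most
      \<open>p / 2\<close>; the summand 1 keeps \<open>K\<close> positive.\<close>
    define K where "K = 2 * (I + 1) / p"
    have I: "0 \<le> I" by (simp add: I_def)
    then have K: "0 < K" using c by (simp add: K_def)
    have "prob {x. K < norm x} \<le> prob {x \<in> space P0. K \<le> (1 + norm x)\<^sup>2}"
    proof (rule finite_measure_mono)
      have "norm x \<le> (1 + norm x)\<^sup>2" for x :: "real ^ 'n" by (simp add: power2_eq_square algebra_simps)
      then show "{x. K < norm x} \<subseteq> {x \<in> space P0. K \<le> (1 + norm x)\<^sup>2}"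
        using space by (auto intro: order_trans[OF less_imp_le])
    qed (simp add: space P0_borel)
    also have "\<dots> \<le> I / K"
      unfolding I_def using moment K by (intro integral_Markov_inequality_measure[where A = "{}"]) auto
    also have "\<dots> \<le> p / 2" using K I c by (simp add: K_def field_simps)
    finally show thesis using that[of K] K by simp
  qed
  \<comment> \<open>None of these depends on \<open>\<delta>\<close>. On the region
    \<open>m \<le> lam \<le> \<Lambda>\<close>, where \<open>K2\<close> at
    \<open>\<delta> = 1\<close> dominates \<open>K2\<close> at smaller values. \<open>Q\<close>
    gives \<open>ratio \<le> sqrt \<delta> * Q\<close>, since the square of
    \<open>norm \<beta>\<close> over \<open>lam\<close> is at most \<open>R / k1\<close>.
    \<open>G\<close> bounds \<open>l'\<close> at the state when \<open>norm x \<le> K\<close> and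
    \<open>ratio * M \<le> 1 / 2\<close>, and \<open>b\<close> is half the least value of
    \<open>c2 * norm \<beta>\<close> guaranteed by \<open>r\<close>.\<close>
  define k1 where "k1 = K1 Llow \<rho>max"
  define m where "m = k1 * r"
  define \<Lambda> where "\<Lambda> = K2 Lup \<rho>min M R 1 * R"
  define Q where "Q = R / (2 * k1 * \<rho>min)"
  define G where "G = (\<bar>deriv l 0\<bar> + M * (R * K)) / (1 - 1 / 2)"
  define b where "b = c2 * r / 2"
  have k1: "0 < k1" using L_pos rho_pos by (simp add: k1_def K1_def)
  have m: "0 < m" using k1 r by (simp add: m_def)
  have K2p: "0 < K2 Lup \<rho>min M R 1"
    using L_pos rho_pos R M_pos by (simp add: K2_def add_pos_pos)
  then have \<Lambda>: "0 < \<Lambda>" using R by (simp add: \<Lambda>_def)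
  have Q: "0 < Q" using R k1 rho_pos by (simp add: Q_def)
  have G: "0 \<le> G" using R K M_pos by (simp add: G_def)
  have b: "0 < b" using c r by (simp add: b_def)
  obtain k where k: "0 < k" "\<And>u. \<bar>u\<bar> \<le> R * K + b \<Longrightarrow> k \<le> deriv (deriv l) u"
  proof -
    \<comment> \<open>The extra 1 places the closed range of the states inside the open interval on
      which \<open>sc\<close> bounds the second derivative.\<close>
    let ?U = "R * K + b + 1"
    have "- ?U \<le> ?U" using R K b by (simp add: add_nonneg_nonneg)
    from sc[OF this] show thesis using that by (force simp: abs_le_iff)
  qed
  obtain \<kappa> where \<kappa>: "0 < \<kappa>" and lower:
    "\<And>s (P :: real ^ 'n ^ 'n) x y h. \<lbrakk>\<And>v w. (P *v v) \<bullet> w = v \<bullet> (P *v w);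
       \<And>v. norm (P *v v) \<le> 1 / \<rho>min * norm v; \<And>w. (norm w)\<^sup>2 / \<rho>max \<le> w \<bullet> (P *v w);
       0 < s; s \<le> 1; m \<le> snd y; snd y \<le> \<Lambda>; norm (fst y) \<le> R; \<bar>ratio s P y\<bar> * M < 1; norm x \<le> K;
       \<bar>deriv l (state s P x y)\<bar> \<le> G; c1 / 2 \<le> \<bar>deriv l (state s P x y)\<bar>; b \<le> \<bar>state s P x y\<bar>;
       k \<le> deriv (deriv l) (state s P x y)\<rbrakk>
     \<Longrightarrow> s * \<kappa> * (norm h)\<^sup>2 \<le> loss_hess s P x y h \<bullet> h"
    by (rule loss_hess_lower_bound[of m \<Lambda> R K G "c1 / 2" b k \<rho>min \<rho>max])
      (use m \<Lambda> R K G c b k rho_pos in auto)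
  \<comment> \<open>For \<open>s \<le> s0\<close> the three terms give \<open>s \<le> 1\<close>,
    \<open>s * Q * M \<le> 1 / 2\<close> and \<open>s * Q * G \<le> b\<close>; \<open>G + 1\<close>
    avoids a division by zero.\<close>
  define s0 where "s0 = min 1 (min (1 / (2 * Q * M)) (b / (Q * (G + 1))))"
  have s0: "0 < s0" using Q M_pos b G by (simp add: s0_def)
  \<comment> \<open>Halving makes the inequality with \<open>delta0\<close> strict.\<close>
  define \<delta>1 where "\<delta>1 = min (s0\<^sup>2) (delta0 Llow \<rho>min \<rho>max M R) / 2"
  have d0: "0 < delta0 Llow \<rho>min \<rho>max M R"
    using L_pos rho_pos R M_pos by (simp add: delta0_def)
  have \<delta>1: "0 < \<delta>1" "\<delta>1 < delta0 Llow \<rho>min \<rho>max M R" "\<delta>1 \<le> s0\<^sup>2"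
    using d0 zero_less_power[OF s0, of 2] unfolding \<delta>1_def by linarith+

  \<comment> \<open>The Loewner bound at a fixed \<open>\<delta>\<close> and
    \<open>\<theta>\<close>\<close>
  have "\<exists>H. has_hessian (robust_objective P0 l A \<delta>) H \<theta> \<and> loewner_ge H (\<lambda>v. (sqrt \<delta> * (\<kappa> * (p / 2))) *\<^sub>R v)"
    if \<delta>: "0 < \<delta>" "\<delta> < \<delta>1" and \<theta>: "\<theta> \<in> strong_convexity_region B Llow Lup \<rho>min \<rho>max M \<delta>" for \<delta> \<theta>
  proof -
    define s where "s = sqrt \<delta>"
    define \<beta> where "\<beta> = fst \<theta>"
    define lam where "lam = snd \<theta>"
    define P where "P = (\<lambda>x. matrix_inv (A x))"
    define H where "H h = (\<integral>x. loss_hess s (P x) x \<theta> h \<partial>P0)" for h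
    have s: "0 < s" "s \<le> s0"
    proof -
      have "sqrt \<delta> \<le> sqrt (s0\<^sup>2)" using \<delta> \<delta>1 by (intro real_sqrt_le_mono) auto
      then show "s \<le> s0" using s0 by (simp add: s_def)
    qed (use \<delta> in \<open>simp add: s_def\<close>)
    have s1: "s \<le> 1" using s by (simp add: s0_def)
    have sQM: "s * Q * M \<le> 1 / 2"
    proof -
      have "s \<le> 1 / (2 * Q * M)" using s by (simp add: s0_def)
      then show ?thesis using Q M_pos by (simp add: field_simps)
    qed
    have sQG: "s * Q * G \<le> b"
    proof -
      have "s \<le> b / (Q * (G + 1))" using s by (simp add: s0_def)
      moreover have "0 < Q * (G + 1)" using Q G by (simp add: add_nonneg_pos)
      ultimately have "s * (Q * (G + 1)) \<le> b" by (simp only: pos_le_divide_eq)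
      moreover have "0 < s * Q" using s Q by simp
      ultimately show ?thesis by (simp add: algebra_simps)
    qed
    have \<beta>: "\<beta> \<in> B" and lam: "k1 * norm \<beta> \<le> lam" "lam \<le> K2 Lup \<rho>min M R \<delta> * norm \<beta>"
      using \<theta> by (auto simp: strong_convexity_region_def \<beta>_def lam_def k1_def R_def split_beta)
    have nb: "r \<le> norm \<beta>" "norm \<beta> \<le> R" "0 < norm \<beta>" using r RB \<beta> by force+
    have lam_ge: "m \<le> lam" using lam(1) mult_left_mono[OF nb(1) less_imp_le[OF k1]] unfolding m_def by linarith
    have lam_pos: "0 < lam" using lam_ge m by simp
    have lam_le: "lam \<le> \<Lambda>"
    proof -
      have "K2 Lup \<rho>min M R \<delta> \<le> K2 Lup \<rho>min M R 1"
        using s1 M_pos R rho_pos unfolding K2_def s_def[symmetric] by (auto intro!: mult_right_mono)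
      then have "K2 Lup \<rho>min M R \<delta> * norm \<beta> \<le> K2 Lup \<rho>min M R 1 * R"
        using nb K2p by (intro mult_mono) auto
      then show ?thesis using lam(2) by (simp add: \<Lambda>_def)
    qed
    have q_le: "s * (norm \<beta>)\<^sup>2 / \<rho>min / (2 * lam) \<le> s * Q"
    proof -
      have "(norm \<beta>)\<^sup>2 * k1 \<le> R * lam"
        using mult_mono[OF nb(2) lam(1)] nb R k1 by (simp add: power2_eq_square mult_ac)
      then show ?thesis using s lam_pos k1 rho_pos
        by (simp add: Q_def field_simps)
    qed
    have inv: "AE x in P0. (\<forall>v. norm (P x *v v) \<le> 1 / \<rho>min * norm v) \<and> (\<forall>w. (norm w)\<^sup>2 / \<rho>max \<le> w \<bullet> (P x *v w))"
      using A_bounds by eventually_elim (use spd_inv_bounds[OF A_spd rho_pos] in \<open>auto simp: P_def\<close>)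
    have sym: "(P x *v v) \<bullet> w = v \<bullet> (P x *v w)" for x v w
      unfolding P_def by (rule spd_inv_self_adjoint[OF A_spd])
    have q: "0 \<le> ratio s (P x) \<theta> \<and> ratio s (P x) \<theta> \<le> s * Q"
      if x: "\<forall>v. norm (P x *v v) \<le> 1 / \<rho>min * norm v" "\<forall>w. (norm w)\<^sup>2 / \<rho>max \<le> w \<bullet> (P x *v w)" for x
    proof -
      have "0 \<le> \<beta> \<bullet> (P x *v \<beta>)" using x(2) rho_pos by (meson divide_nonneg_pos order_trans zero_le_power2)
      moreover have "\<beta> \<bullet> (P x *v \<beta>) \<le> norm \<beta> * (1 / \<rho>min * norm \<beta>)"
        using x(1) by (intro order_trans[OF norm_cauchy_schwarz] mult_left_mono) auto
      then have "s * (\<beta> \<bullet> (P x *v \<beta>)) \<le> s * (norm \<beta> * (1 / \<rho>min * norm \<beta>))"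
        using s by (intro mult_left_mono) auto
      then have "s * (\<beta> \<bullet> (P x *v \<beta>)) / (2 * lam) \<le> s * (norm \<beta>)\<^sup>2 / \<rho>min / (2 * lam)"
        using lam_pos by (intro divide_right_mono) (simp_all add: power2_eq_square)
      ultimately show ?thesis using q_le s lam_pos by (simp add: ratio_def \<beta>_def lam_def)
    qed
    have qM: "\<bar>ratio s (P x) \<theta>\<bar> * M \<le> 1 / 2"
      if x: "\<forall>v. norm (P x *v v) \<le> 1 / \<rho>min * norm v" "\<forall>w. (norm w)\<^sup>2 / \<rho>max \<le> w \<bullet> (P x *v w)" for x
    proof -
      have "\<bar>ratio s (P x) \<theta>\<bar> * M \<le> s * Q * M" using q[OF x] M_pos by (intro mult_right_mono) auto
      then show ?thesis using sQM by linarith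
    qed
    have small: "sqrt \<delta> * (norm (fst \<theta>))\<^sup>2 * M < 2 * snd \<theta> * \<rho>min"
    proof -
      have "s * (norm \<beta>)\<^sup>2 / \<rho>min / (2 * lam) * M \<le> 1 / 2"
        using mult_right_mono[OF q_le less_imp_le[OF M_pos]] sQM by linarith
      then have "s * (norm \<beta>)\<^sup>2 * M \<le> lam * \<rho>min" using rho_pos lam_pos by (simp add: field_simps)
      moreover have "0 < lam * \<rho>min" using rho_pos lam_pos by simp
      ultimately show ?thesis unfolding s_def \<beta>_def lam_def by linarith
    qed
    have hess: "has_hessian (robust_objective P0 l A \<delta>) H \<theta>"
      and int: "integrable P0 (\<lambda>x. loss_hess s (P x) x \<theta> h)" for h
      unfolding H_def[abs_def] s_def P_def
      using has_hessian_robust_objective[OF P0_borel A_spd cost_lsc rho_pos A_bounds moment \<delta>(1) _ _ small]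
        nb lam_pos by (auto simp: \<beta>_def lam_def)
    have H_inner: "H h \<bullet> v = (\<integral>x. loss_hess s (P x) x \<theta> h \<bullet> v \<partial>P0)" for h v
      unfolding H_def using int by simp
    have lin: "linear H"
      using hess unfolding has_hessian_def by (blast intro: bounded_linear.linear has_derivative_bounded_linear)
    \<comment> \<open>Symmetry is read off from the bilinear form of the integrand, which avoids a
      theorem on mixed partial derivatives.\<close>
    have symH: "H h \<bullet> v = h \<bullet> H v" for h v
    proof -
      have "AE x in P0. loss_hess s (P x) x \<theta> h \<bullet> v = loss_hess s (P x) x \<theta> v \<bullet> h"
        using inv
      proof eventually_elim
        case (elim x)
        have nz: "snd \<theta> \<noteq> 0" using lam_pos by (simp add: lam_def)
        have sm: "\<bar>ratio s (P x) \<theta>\<bar> * M < 1" using qM[of x] elim by auto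
        have "transverse \<theta> h \<bullet> (P x *v transverse \<theta> v) = transverse \<theta> v \<bullet> (P x *v transverse \<theta> h)"
          by (metis sym inner_commute)
        then show ?case by (simp add: inner_loss_hess[OF sym nz sm] mult_ac)
      qed
      then have "(\<integral>x. loss_hess s (P x) x \<theta> h \<bullet> v \<partial>P0) = (\<integral>x. loss_hess s (P x) x \<theta> v \<bullet> h \<partial>P0)"
        using int by (intro integral_cong_AE borel_measurable_integrable integrable_inner_left) auto
      then show ?thesis by (simp add: H_inner inner_commute[of h])
    qed
    \<comment> \<open>On \<open>E\<close> the spread condition holds and \<open>x\<close> is
      bounded; discarding large \<open>x\<close> costs at most \<open>p / 2\<close> of the
      probability \<open>p\<close>.\<close>
    define E where "E = {x. \<bar>deriv l (\<beta> \<bullet> x)\<bar> > c1 \<and> \<bar>\<beta> \<bullet> x\<bar> > c2 * norm \<beta>} - {x. K < norm x}"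
    have sets: "{x. \<bar>deriv l (\<beta> \<bullet> x)\<bar> > c1 \<and> \<bar>\<beta> \<bullet> x\<bar> > c2 * norm \<beta>} \<in> sets P0" "{x. K < norm x} \<in> sets P0"
      unfolding P0_borel by measurable
    have E: "p / 2 \<le> prob E"
    proof -
      have "prob {x. \<bar>deriv l (\<beta> \<bullet> x)\<bar> > c1 \<and> \<bar>\<beta> \<bullet> x\<bar> > c2 * norm \<beta>} \<le> prob (E \<union> {x. K < norm x})"
        using sets by (intro finite_measure_mono) (auto simp: E_def)
      also have "\<dots> \<le> prob E + prob {x. K < norm x}"
        using sets by (intro measure_Un_le) (auto simp: E_def)
      finally show ?thesis using spread[OF \<beta>] K(2) by simp
    qed
    have low: "s * (\<kappa> * (p / 2)) * (norm h)\<^sup>2 \<le> H h \<bullet> h" for h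
    proof -
      have "s * (\<kappa> * (p / 2)) * (norm h)\<^sup>2 = s * \<kappa> * (norm h)\<^sup>2 * (p / 2)" by simp
      also have "\<dots> \<le> s * \<kappa> * (norm h)\<^sup>2 * prob E"
        using E s \<kappa> by (intro mult_left_mono) auto
      also have "\<dots> = (\<integral>x. s * \<kappa> * (norm h)\<^sup>2 * indicator E x \<partial>P0)"
        using sets by (simp add: E_def)
      also have "\<dots> \<le> (\<integral>x. loss_hess s (P x) x \<theta> h \<bullet> h \<partial>P0)"
      proof (rule integral_mono_AE)
        show "integrable P0 (\<lambda>x. s * \<kappa> * (norm h)\<^sup>2 * indicator E x)"
          using sets by (intro integrable_mult_right integrable_real_indicator) (auto simp: E_def emeasure_eq_measure)
        show "AE x in P0. s * \<kappa> * (norm h)\<^sup>2 * indicator E x \<le> loss_hess s (P x) x \<theta> h \<bullet> h"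
          using inv
        proof eventually_elim
          case (elim x)
          then have px: "\<forall>v. norm (P x *v v) \<le> 1 / \<rho>min * norm v" "\<forall>w. (norm w)\<^sup>2 / \<rho>max \<le> w \<bullet> (P x *v w)"
            by blast+
          have sm: "\<bar>ratio s (P x) \<theta>\<bar> * M < 1" using qM[OF px] by auto
          show ?case
          proof (cases "x \<in> E")
            case False
            have "0 \<le> w \<bullet> (P x *v w)" for w
              using px(2) rho_pos by (meson divide_nonneg_pos order_trans zero_le_power2)
            then have "0 \<le> loss_hess s (P x) x \<theta> h \<bullet> h"
              using sm s lam_pos by (intro loss_hess_nonneg sym) (auto simp: lam_def)
            then show ?thesis using False by simp
          next
            case True
            let ?u = "state s (P x) x \<theta>"
            have x: "c1 < \<bar>deriv l (\<beta> \<bullet> x)\<bar>" "c2 * norm \<beta> < \<bar>\<beta> \<bullet> x\<bar>" "norm x \<le> K"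
              using True by (auto simp: E_def)
            have gG: "\<bar>deriv l ?u\<bar> \<le> G"
              unfolding G_def by (rule l1_state_le[OF qM[OF px] _ _ x(3)]) (use nb in \<open>auto simp: \<beta>_def\<close>)
            \<comment> \<open>Passing from \<open>\<beta> \<bullet> x\<close> to the state costs at
              most a factor 2, because \<open>ratio\<close> times \<open>M\<close> is below
              1.\<close>
            have "c1 \<le> (1 + \<bar>ratio s (P x) \<theta>\<bar> * M) * \<bar>deriv l ?u\<bar>"
              using l1_prox_ge[OF sm, of "\<beta> \<bullet> x"] x by (simp add: state_def \<beta>_def)
            also have "\<dots> \<le> 2 * \<bar>deriv l ?u\<bar>"
              using sm by (intro mult_right_mono) auto
            finally have g: "c1 / 2 \<le> \<bar>deriv l ?u\<bar>" by simp
            \<comment> \<open>The state moves by at most \<open>b\<close>, while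
              \<open>\<bar>\<beta> \<bullet> x\<bar>\<close> exceeds \<open>2 * b\<close>; so the
              state stays away from 0 and within the range on which \<open>k\<close> was
              chosen.\<close>
            have "\<bar>?u - \<beta> \<bullet> x\<bar> \<le> b"
            proof -
              have "?u - \<beta> \<bullet> x = ratio s (P x) \<theta> * deriv l ?u"
                using prox_eq[OF sm, of "\<beta> \<bullet> x"] by (simp add: state_def \<beta>_def)
              then have "\<bar>?u - \<beta> \<bullet> x\<bar> = ratio s (P x) \<theta> * \<bar>deriv l ?u\<bar>"
                using q[OF px] by (simp add: abs_mult)
              also have "\<dots> \<le> s * Q * G"
                using q[OF px] gG s Q by (intro mult_mono) auto
              finally show ?thesis using sQG by simp
            qed
            moreover have "2 * b \<le> c2 * norm \<beta>" using nb c by (simp add: b_def)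
            moreover have "\<bar>\<beta> \<bullet> x\<bar> \<le> R * K"
              by (rule order_trans[OF Cauchy_Schwarz_ineq2 mult_mono]) (use nb x R in auto)
            ultimately have u: "b \<le> \<bar>?u\<bar>" "\<bar>?u\<bar> \<le> R * K + b" using x(2) by linarith+
            have "s * \<kappa> * (norm h)\<^sup>2 \<le> loss_hess s (P x) x \<theta> h \<bullet> h"
              by (rule lower) (use sym px s s1 lam_ge lam_le nb sm x gG g u k(2)[OF u(2)] in \<open>auto simp: \<beta>_def lam_def\<close>)
            then show ?thesis using True by simp
          qed
        qed
      qed (use int in simp)
      finally show ?thesis by (simp add: H_inner)
    qed
    have "loewner_ge H (\<lambda>v. (sqrt \<delta> * (\<kappa> * (p / 2))) *\<^sub>R v)"
      unfolding loewner_ge_def psd_operator_def s_def[symmetric]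
    proof (intro conjI allI)
      show "linear (\<lambda>v. H v - (s * (\<kappa> * (p / 2))) *\<^sub>R v)"
        by (intro linear_compose_sub lin linear_scale_self)
      show "(H u - (s * (\<kappa> * (p / 2))) *\<^sub>R u) \<bullet> v = u \<bullet> (H v - (s * (\<kappa> * (p / 2))) *\<^sub>R v)" for u v
        by (simp add: inner_diff_left inner_diff_right symH)
      show "0 \<le> v \<bullet> (H v - (s * (\<kappa> * (p / 2))) *\<^sub>R v)" for v
        using low[of v] by (simp add: inner_diff_right inner_commute[of v "H v"] power2_norm_eq_inner)
    qed
    then show ?thesis using hess by blast
  qed
  moreover have "0 < \<kappa> * (p / 2)" using \<kappa> c by simp
  ultimately show ?thesis using \<delta>1 unfolding R_def by blast
qed

end
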